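(* Let $m\ge 1$ and let $\mathcal{G}=([m],E)$ be an undirected graph. For a generic matrix $K\in\mathcal{S}^+_{\mathcal{G}}$, the dimension of the stabilizer $G^0_K=\{g\in G^0 \mid g\cdot K=K\}$ of $K$ in $G^0$ equals $$\sum_{\bar i\in[m]/\sim}\binom{n_{\bar i}}{2},\qquad\text{where}\qquad n_{\bar i}:=\max\Bigl\{0,\ |\bar i|-\sum_{\bar j\in N(\bar i),\ \bar i\not\preccurlyeq\bar j\not\preccurlyeq\bar i}|\bar j|\Bigr\},$$ the inner sum ranging over all neighbors $\bar j$ of $\bar i$ in $\widetilde{\mathcal{G}}$ that are not comparable to $\bar i$ in the partial order $\preccurlyeq$ on $[m]/\sim$.
   Context: Graphs are finite and simple, $[m]=\{1,\dots,m\}$, and $E$ is a set of two-element subsets of $[m]$. $\mathcal{S}_{\mathcal{G}}$ is the linear space of real symmetric $m\times m$ matrices whose $(i,j)$ entry is zero whenever $i\ne j$ and $\{i,j\}\notin E$; $\mathcal{S}^+_{\mathcal{G}}$ is the set of positive definite matrices in $\mathcal{S}_{\mathcal{G}}$. $\mathrm{GL}_m(\mathbb{R})$ acts on real symmetric $m\times m$ matrices by $g\cdot K=g^{-T}Kg^{-1}$. Writing $N(i)=\{j\in[m]: \{i,j\}\in E\}$, the pre-order $\preccurlyeq$ on $[m]$ is defined by $i\preccurlyeq j$ iff $N(j)\cup\{j\}\subseteq N(i)\cup\{i\}$; $i\sim j$ means $i\preccurlyeq j$ and $j\preccurlyeq i$; $\bar i$ is the $\sim$-class of $i$; and $\preccurlyeq$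 induces a partial order on $[m]/\sim$ by $\bar i\preccurlyeq\bar j$ iff $i\preccurlyeq j$. The group $G^0=\{g\in\mathrm{GL}_m(\mathbb{R}) \mid g_{ij}=0\text{ for all } i,j \text{ with } j\not\preccurlyeq i\}$ maps $\mathcal{S}^+_{\mathcal{G}}$ to itself. The graph $\widetilde{\mathcal{G}}$ has vertex set $[m]/\sim$, with an edge between distinct classes $\bar i$ and $\bar j$ iff $\{i,j\}\in E$ (this does not depend on representatives); $N(\bar i)$ is the set of neighbors of $\bar i$ in $\widetilde{\mathcal{G}}$. Dimension means dimension as a real Lie group. "For a generic $K\in\mathcal{S}^+_{\mathcal{G}}$" means: for all $K\in\mathcal{S}^+_{\mathcal{G}}$ outside the zero set of some nonzero polynomial on $\mathcal{S}_{\mathcal{G}}$. *)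

theory Defs
  imports "HOL-Analysis.Analysis"
begin

text \<open>Lie group dimension. The Lie groups at hand are subgroups of a general linear group, with
  the manifold structure of an embedded smooth submanifold of the space of matrices.\<close>

primrec Ck_on :: "nat \<Rightarrow> 'a::euclidean_space set \<Rightarrow> ('a \<Rightarrow> 'b::euclidean_space) \<Rightarrow> bool" where
  "Ck_on 0 U f \<longleftrightarrow> continuous_on U f"
| "Ck_on (Suc k) U f \<longleftrightarrow>
     (\<forall>x\<in>U. f differentiable (at x)) \<and> (\<forall>v. Ck_on k U (\<lambda>x. frechet_derivative f (at x) v))"

text \<open>Only meaningful for open \<open>U\<close>, since the derivatives are taken in the ambient space.\<close>

definition smooth_on :: "'a::euclidean_space set \<Rightarrow> ('a \<Rightarrow> 'b::euclidean_space) \<Rightarrow> bool" where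
  "smooth_on U f \<longleftrightarrow> (\<forall>k. Ck_on k U f)"

definition diffeomorphism :: 
  "'a::euclidean_space set \<Rightarrow> 'b::euclidean_space set \<Rightarrow> ('a \<Rightarrow> 'b) \<Rightarrow> ('b \<Rightarrow> 'a) \<Rightarrow> bool" where
  "diffeomorphism U V f g \<longleftrightarrow>
     open U \<and> open V \<and> homeomorphism U V f g \<and> smooth_on U f \<and> smooth_on V g"

text \<open>Embedded smooth submanifolds of pure dimension \<open>d\<close>, by slice charts.\<close>

definition embedded_submanifold :: "nat \<Rightarrow> 'a::euclidean_space set \<Rightarrow> bool" where
  "embedded_submanifold d S \<longleftrightarrow>
     (\<forall>p\<in>S. \<exists>(U::'a set) (V::'a set) f g W.
        p \<in> U \<and> diffeomorphism U V f g \<and> subspace W \<and> dim W = d \<and> f ` (U \<inter> S) = V \<inter> W)"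

definition GL :: "(real^'v^'v) set" where
  "GL = {g. invertible g}"

definition GL_subgroup :: "(real^'v^'v) set \<Rightarrow> bool" where
  "GL_subgroup H \<longleftrightarrow> H \<subseteq> GL \<and> mat 1 \<in> H \<and>
     (\<forall>g\<in>H. \<forall>h\<in>H. g ** h \<in> H) \<and> (\<forall>g\<in>H. matrix_inv g \<in> H)"

text \<open>\<open>H\<close> is a Lie group of dimension \<open>d\<close>; its operations are smooth because they are
  restrictions of those of \<open>GL\<close>. As \<open>H\<close> is nonempty, \<open>d\<close> is unique.\<close>

definition has_lie_group_dim :: "(real^'v^'v) set \<Rightarrow> nat \<Rightarrow> bool" where
  "has_lie_group_dim H d \<longleftrightarrow> GL_subgroup H \<and> embedded_submanifold d H"

text \<open>Graphs. The vertex set is a finite type \<open>'v\<close>, the edge set a set of two-element sets.\<close>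

definition simple_graph :: "'v set set \<Rightarrow> bool" where
  "simple_graph E \<longleftrightarrow> (\<forall>e\<in>E. card e = 2)"

definition nbrs :: "'v set set \<Rightarrow> 'v \<Rightarrow> 'v set" where
  "nbrs E i = {j. {i, j} \<in> E}"

definition vle :: "'v set set \<Rightarrow> 'v \<Rightarrow> 'v \<Rightarrow> bool" where
  "vle E i j \<longleftrightarrow> nbrs E j \<union> {j} \<subseteq> nbrs E i \<union> {i}"

definition vequiv :: "'v set set \<Rightarrow> ('v \<times> 'v) set" where
  "vequiv E = {(i, j). vle E i j \<and> vle E j i}"

definition vclasses :: "'v set set \<Rightarrow> 'v set set" where
  "vclasses E = UNIV // vequiv E"

text \<open>The order and the adjacency below do not depend on the representatives of the classes.\<close>

definition cle :: "'v set set \<Rightarrow> 'v set \<Rightarrow> 'v set \<Rightarrow> bool" where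
  "cle E c d \<longleftrightarrow> (\<exists>i\<in>c. \<exists>j\<in>d. vle E i j)"

definition cnbrs :: "'v set set \<Rightarrow> 'v set \<Rightarrow> 'v set set" where
  "cnbrs E c = {d \<in> vclasses E. d \<noteq> c \<and> (\<exists>i\<in>c. \<exists>j\<in>d. {i, j} \<in> E)}"

definition excess :: "'v set set \<Rightarrow> 'v set \<Rightarrow> nat" where
  "excess E c =
     nat (max 0 (int (card c) -
       (\<Sum>d\<in>{d \<in> cnbrs E c. \<not> cle E c d \<and> \<not> cle E d c}. int (card d))))"

definition sym_space :: "'v set set \<Rightarrow> (real^'v^'v) set" where
  "sym_space E = {K. transpose K = K \<and> (\<forall>i j. i \<noteq> j \<and> {i, j} \<notin> E \<longrightarrow> K $ i $ j = 0)}"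

definition pos_def :: "real^'v^'v \<Rightarrow> bool" where
  "pos_def K \<longleftrightarrow> transpose K = K \<and> (\<forall>x. x \<noteq> 0 \<longrightarrow> x \<bullet> (K *v x) > 0)"

definition pd_cone :: "'v set set \<Rightarrow> (real^'v^'v) set" where
  "pd_cone E = {K \<in> sym_space E. pos_def K}"

definition act :: "real^'v^'v \<Rightarrow> real^'v^'v \<Rightarrow> real^'v^'v" where
  "act g K = transpose (matrix_inv g) ** K ** matrix_inv g"

definition G0 :: "'v set set \<Rightarrow> (real^'v^'v) set" where
  "G0 E = {g \<in> GL. \<forall>i j. \<not> vle E j i \<longrightarrow> g $ i $ j = 0}"

definition G0_stabilizer :: "'v set set \<Rightarrow> real^'v^'v \<Rightarrow> (real^'v^'v) set" where
  "G0_stabilizer E K = {g \<in> G0 E. act g K = K}"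

text \<open>\<open>P\<close> holds on the part of the positive definite cone outside the zero set of some nonzero
  polynomial on the linear space \<open>sym_space E\<close>. Such polynomials are the restrictions of
  polynomials on all matrices, and being nonzero means not vanishing identically on
  \<open>sym_space E\<close>.\<close>

definition generically :: "'v::finite set set \<Rightarrow> (real^'v^'v \<Rightarrow> bool) \<Rightarrow> bool" where
  "generically E P \<longleftrightarrow>
     (\<exists>p. real_polynomial_function p \<and> (\<exists>L\<in>sym_space E. p L \<noteq> 0) \<and>
        (\<forall>K\<in>pd_cone E. p K \<noteq> 0 \<longrightarrow> P K))"

end

theory Submission
  imports Defs
begin

text \<open>Write \<open>A\<close> for the algebra of matrices \<open>g\<close> with \<open>g\<^sub>i\<^sub>j = 0\<close> unless \<open>j \<preceq> i\<close>, whose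
  invertible elements form \<open>G\<^sup>0\<close>. The stabilizer of \<open>K\<close> consists of the isometries
  \<open>g\<^sup>T K g = K\<close> in \<open>A\<close>, and the Cayley transform provides slice charts which identify it locally
  with the linear space \<open>h\<^sub>K\<close> of all \<open>X \<in> A\<close> with \<open>X\<^sup>T K + K X = 0\<close>
  (\<open>isom_group_lie_dim\<close>). So the dimension of the group is that of the vector space \<open>h\<^sub>K\<close>.

  Lower bound, for every \<open>K\<close> in \<open>pd_cone E\<close> (\<open>pair_set_le_dim\<close>). The group preserves the span
  of the \<open>e\<^sub>k\<close> with \<open>i \<preceq> k\<close>, for each \<open>i\<close>, and therefore the \<open>K\<close>-orthogonal complement \<open>W\<^sub>c\<close>
  of its part strictly above the class \<open>c\<close> of \<open>i\<close>. The space \<open>W\<^sub>c\<close> has dimension \<open>card c\<close>, and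
  the whole space is the direct sum of the \<open>W\<^sub>c\<close>. Those of comparable classes, and those of
  incomparable classes without an edge between them, are orthogonal; so only incomparable neighbors
  interact, and the vectors in \<open>W\<^sub>c\<close> orthogonal to all other \<open>W\<^sub>d\<close> form a subspace (the core)
  whose dimension is at least the excess of \<open>c\<close> (\<open>dim_core\<close>). The orthogonal group of each core,
  extended by the identity on the orthogonal complement, lies in the stabilizer, which accounts for
  the sum of the \<open>excess E c choose 2\<close>.

  Upper bound, for generic \<open>K\<close>. The equation that defines \<open>h\<^sub>K\<close> is linear in \<open>X\<close> with coefficients
  depending polynomially on \<open>K\<close>. That a chosen set \<open>Q\<close> of entries determines the elements of
  \<open>h\<^sub>K\<close> is the injectivity of a linear map, hence holds wherever a certain determinant does not
  vanish (\<open>injectivity_polynomial\<close>, applied to \<open>gram\<close>), and it implies \<open>dim h\<^sub>K \<le> card Q\<close>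
  (\<open>dim_skew_algebra_le\<close>). Thus a single matrix \<open>L\<close> for which it holds, with a set \<open>Q\<close> of the right
  size, makes the polynomial nonzero and settles the generic case. Such an \<open>L\<close> couples the classes
  by weighted injections with distinct weights (\<open>rigid_form_exists\<close>): of two coupled classes,
  the smaller one is then frozen, and freezes in the larger one as many directions as it has
  vertices, until none are left.\<close>

section \<open>Smooth maps\<close>

lemma Ck_on_cong:
  assumes "open U" "\<And>x. x \<in> U \<Longrightarrow> f x = g x" "Ck_on k U f"
  shows "Ck_on k U g"
  using assms(2,3)
proof (induction k arbitrary: f g)
  case 0
  then show ?case by (auto cong: continuous_on_cong)
next
  case (Suc k)
  have d: "(g has_derivative frechet_derivative f (at x)) (at x)" if "x \<in> U" for x
  proof (rule has_derivative_transform_within_open[OF _ assms(1) that])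
    show "(f has_derivative frechet_derivative f (at x)) (at x)"
      using Suc.prems(2) that by (simp add: frechet_derivative_works[symmetric])
  qed (use Suc.prems(1) in auto)
  have "Ck_on k U (\<lambda>x. frechet_derivative g (at x) v)" for v
  proof (rule Suc.IH)
    show "Ck_on k U (\<lambda>x. frechet_derivative f (at x) v)" using Suc.prems by simp
    show "frechet_derivative f (at x) v = frechet_derivative g (at x) v" if "x \<in> U" for x
      using frechet_derivative_at[OF d[OF that]] by simp
  qed
  then show ?case using d by (auto simp: differentiable_def)
qed

text \<open>The recursive clause for \<open>Ck_on\<close> speaks of \<open>frechet_derivative\<close>, a choice operator; this
  form lets an explicit derivative take its place.\<close>
lemma Ck_on_SucI:
  assumes "open U" "\<And>x. x \<in> U \<Longrightarrow> (f has_derivative f' x) (at x)"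
    and "\<And>v. Ck_on k U (\<lambda>x. f' x v)"
  shows "Ck_on (Suc k) U f"
proof -
  have "Ck_on k U (\<lambda>x. frechet_derivative f (at x) v)" for v
    using frechet_derivative_at[OF assms(2)] by (intro Ck_on_cong[OF assms(1) _ assms(3)]) auto
  then show ?thesis using assms(2) by (auto simp: differentiable_def)
qed

lemma Ck_on_SucD: "Ck_on (Suc k) U f \<Longrightarrow> Ck_on k U f"
proof (induction k arbitrary: f)
  case 0
  then show ?case
    by (auto simp: continuous_at_imp_continuous_on differentiable_imp_continuous_within)
next
  case (Suc k)
  then show ?case by (metis Ck_on.simps(2))
qed

lemma Ck_on_const: "open U \<Longrightarrow> Ck_on k U (\<lambda>x. c)"
proof (induction k arbitrary: c)
  case (Suc k)
  show ?case
    by (rule Ck_on_SucI[where f' = "\<lambda>x v. 0"]) (auto simp: Suc)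
qed auto

lemma Ck_on_add:
  assumes "open U" "Ck_on k U f" "Ck_on k U g"
  shows "Ck_on k U (\<lambda>x. f x + g x)"
  using assms(2,3)
proof (induction k arbitrary: f g)
  case (Suc k)
  show ?case
  proof (rule Ck_on_SucI[OF assms(1)])
    show "((\<lambda>x. f x + g x) has_derivative
        (\<lambda>v. frechet_derivative f (at x) v + frechet_derivative g (at x) v)) (at x)" if "x \<in> U" for x
      using Suc.prems that by (auto intro!: derivative_intros simp: frechet_derivative_works[symmetric])
  qed (use Suc in auto)
qed (auto intro: continuous_intros)

lemma Ck_on_bilinear:
  assumes "bounded_bilinear b" "open U" "Ck_on k U f" "Ck_on k U g"
  shows "Ck_on k U (\<lambda>x. b (f x) (g x))"
  using assms(3,4)
proof (induction k arbitrary: f g)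
  case 0
  then show ?case using bounded_bilinear.continuous_on[OF assms(1)] by auto
next
  case (Suc k)
  show ?case
  proof (rule Ck_on_SucI[OF assms(2)])
    show "((\<lambda>x. b (f x) (g x)) has_derivative (\<lambda>v. b (f x) (frechet_derivative g (at x) v) +
        b (frechet_derivative f (at x) v) (g x))) (at x)" if "x \<in> U" for x
      using Suc.prems that
      by (intro bounded_bilinear.FDERIV[OF assms(1)]) (auto simp: frechet_derivative_works[symmetric])
    show "Ck_on k U (\<lambda>x. b (f x) (frechet_derivative g (at x) v) +
        b (frechet_derivative f (at x) v) (g x))" for v
      using Suc.prems by (intro Ck_on_add assms Suc.IH Ck_on_SucD[of k U f] Ck_on_SucD[of k U g]) auto
  qed
qed

section \<open>Smoothness of matrix inversion\<close>

lemma bounded_bilinear_matrix_mult: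
  "bounded_bilinear ((**) :: real^'n^'m \<Rightarrow> real^'p^'n \<Rightarrow> real^'p^'m)"
proof -
  have "bilinear ((**) :: real^'n^'m \<Rightarrow> real^'p^'n \<Rightarrow> real^'p^'m)"
    by (auto simp: bilinear_def linear_iff matrix_matrix_mult_def vec_eq_iff sum.distrib
        algebra_simps sum_distrib_left)
  then show ?thesis by (simp add: bilinear_conv_bounded_bilinear)
qed

interpretation matmul: bounded_bilinear "(**) :: real^'n^'m \<Rightarrow> real^'p^'n \<Rightarrow> real^'p^'m"
  by (rule bounded_bilinear_matrix_mult)

lemma matrix_inv_left [simp]: "invertible (A::real^'n^'n) \<Longrightarrow> matrix_inv A ** A = mat 1"
  and matrix_inv_right [simp]: "invertible (A::real^'n^'n) \<Longrightarrow> A ** matrix_inv A = mat 1"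
  unfolding invertible_def matrix_inv_def by (metis (mono_tags, lifting) someI_ex)+

lemma matrix_inv_eqI: "(A::real^'n^'n) ** B = mat 1 \<Longrightarrow> matrix_inv A = B"
  by (metis invertible_right_inverse matrix_inv_left matrix_mul_assoc matrix_mul_lid matrix_mul_rid)

lemma continuous_det: "continuous_on S (\<lambda>x. det (f x :: real^'n^'n))"
  if "\<And>i j. continuous_on S (\<lambda>x. f x $ i $ j)"
  unfolding det_def by (intro continuous_intros that)

lemma open_invertible: "open {A::real^'n^'n. invertible A}"
proof -
  have "continuous_on UNIV (\<lambda>A::real^'n^'n. det A)"
    by (intro continuous_det continuous_intros)
  then have "open ((\<lambda>A::real^'n^'n. det A) -` (- {0}))"
    by (intro open_vimage) auto
  then show ?thesis by (simp add: vimage_def invertible_det_nz)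
qed

text \<open>By Cramer's rule, the entries of the inverse are quotients of determinants.\<close>
lemma continuous_matrix_inv: "continuous_on {A::real^'n^'n. invertible A} matrix_inv"
proof -
  have eq: "matrix_inv A $ i $ j =
      det (\<chi> k l. if l = i then (axis j 1 :: real^'n) $ k else A $ k $ l) / det A"
    if "invertible A" for A :: "real^'n^'n" and i j
  proof -
    have "A *v (matrix_inv A *v axis j 1) = axis j 1"
      using that by (simp add: matrix_vector_mul_assoc)
    then have "matrix_inv A *v axis j 1 =
        (\<chi> i. det (\<chi> k l. if l = i then (axis j 1 :: real^'n) $ k else A $ k $ l) / det A)"
      using that cramer[of A] by (simp add: invertible_det_nz)
    then show ?thesis
      by (metis (no_types, lifting) column_def matrix_vector_mult_basis vec_lambda_beta)
  qed
  have "continuous_on {A::real^'n^'n. invertible A} (\<lambda>A. matrix_inv A $ i $ j)" for i j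
  proof (subst continuous_on_cong[OF refl eq])
    have "continuous_on {A::real^'n^'n. invertible A}
        (\<lambda>A. if l = i then (axis j 1 :: real^'n) $ k else A $ k $ l)" for k l
    proof (cases "l = i")
      case False
      then show ?thesis by (simp add: continuous_on_component)
    qed auto
    then show "continuous_on {A::real^'n^'n. invertible A} (\<lambda>A.
        det (\<chi> k l. if l = i then (axis j 1 :: real^'n) $ k else A $ k $ l) / det A)"
      by (intro continuous_intros continuous_det) (auto simp: invertible_det_nz)
  qed auto
  then have "continuous_on {A::real^'n^'n. invertible A} (\<lambda>A. \<chi> i j. matrix_inv A $ i $ j)"
    by (intro continuous_on_vec_lambda)
  then show ?thesis by simp
qed

text \<open>Since \<open>X\<inverse> - A\<inverse> = - X\<inverse> (X - A) A\<inverse>\<close>, the first order remainder at \<open>A\<close> is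
  \<open>(A\<inverse> - X\<inverse>) (X - A) A\<inverse>\<close>, so that continuity of the inversion already makes it
  \<open>o(norm (X - A))\<close>.\<close>
lemma has_derivative_matrix_inv:
  assumes "invertible (A::real^'n^'n)"
  shows "(matrix_inv has_derivative (\<lambda>V. - (matrix_inv A ** V ** matrix_inv A))) (at A)"
proof -
  let ?B = "matrix_inv A"
  let ?U = "{A::real^'n^'n. invertible A}"
  obtain C where C: "\<And>(X::real^'n^'n) (Y::real^'n^'n). norm (X ** Y) \<le> norm X * norm Y * C" "C > 0"
    using matmul.pos_bounded by blast
  have rem: "norm (matrix_inv X - ?B - - (?B ** (X - A) ** ?B)) / norm (X - A)
      \<le> norm (?B - matrix_inv X) * norm ?B * C\<^sup>2" if "X \<in> ?U" for X
  proof -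
    have "matrix_inv X - ?B - - (?B ** (X - A) ** ?B) = (?B - matrix_inv X) ** (X - A) ** ?B"
    proof -
      have "matrix_inv X ** (X - A) ** ?B = ?B - matrix_inv X"
        using that assms by (simp add: matmul.diff_left matmul.diff_right flip: matrix_mul_assoc)
      then show ?thesis by (simp add: matmul.diff_left)
    qed
    also have "norm \<dots> \<le> norm ((?B - matrix_inv X) ** (X - A)) * norm ?B * C"
      by (rule C)
    also have "\<dots> \<le> (norm (?B - matrix_inv X) * norm (X - A) * C) * norm ?B * C"
      using C by (intro mult_right_mono) auto
    finally show ?thesis
      by (cases "X = A") (auto simp: divide_simps power2_eq_square algebra_simps)
  qed
  have "isCont matrix_inv A"
    using continuous_matrix_inv assms open_invertible continuous_on_eq_continuous_at by blast
  then have "(\<lambda>X. norm (?B - matrix_inv X) * norm ?B * C\<^sup>2) \<midarrow>A\<rightarrow> norm (?B - ?B) * norm ?B * C\<^sup>2"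
    unfolding isCont_def by (intro tendsto_intros)
  then have lim: "(\<lambda>X. norm (?B - matrix_inv X) * norm ?B * C\<^sup>2) \<midarrow>A\<rightarrow> 0" by simp
  have ev: "\<forall>\<^sub>F X in at A. X \<in> ?U"
    using assms open_invertible by (intro eventually_at_in_open') auto
  show ?thesis
    unfolding has_derivative_iff_norm
  proof
    show "bounded_linear (\<lambda>V. - (?B ** V ** ?B))"
      by (intro bounded_linear_minus bounded_linear_compose[OF matmul.bounded_linear_left]
          matmul.bounded_linear_right)
    show "(\<lambda>X. norm (matrix_inv X - ?B - - (?B ** (X - A) ** ?B)) / norm (X - A)) \<midarrow>A\<rightarrow> 0"
      by (rule tendsto_sandwich[OF _ _ tendsto_const lim])
        (use eventually_mono[OF ev rem] in \<open>auto intro: always_eventually\<close>)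
  qed
qed

text \<open>The derivative of the inversion is a product in which the inversion itself occurs, so the
  differentiability class raises itself by induction.\<close>
lemma Ck_on_matrix_inv_affine:
  fixes A B :: "real^'n^'n"
  assumes U: "open U" "\<And>X. X \<in> U \<Longrightarrow> invertible (A + B ** X)"
  shows "Ck_on k U (\<lambda>X. matrix_inv (A + B ** X))"
proof (induction k)
  case 0
  have "continuous_on U (\<lambda>X. A + B ** X)"
    by (intro continuous_intros matmul.continuous_on)
  then have "continuous_on U (matrix_inv \<circ> (\<lambda>X. A + B ** X))"
    using U by (intro continuous_on_compose continuous_on_subset[OF continuous_matrix_inv]) auto
  then show ?case by (simp add: o_def)
next
  case (Suc k)
  have lin: "((\<lambda>X. A + B ** X) has_derivative (\<lambda>V. B ** V)) (at X)" for X :: "real^'n^'n"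
    by (auto intro!: derivative_eq_intros matmul.FDERIV has_derivative_const)
  show ?case
  proof (rule Ck_on_SucI[OF U(1)])
    show "((\<lambda>X. matrix_inv (A + B ** X)) has_derivative
        (\<lambda>V. matrix_inv (A + B ** X) ** (- (B ** V)) ** matrix_inv (A + B ** X))) (at X)"
      if "X \<in> U" for X
      using has_derivative_compose[OF lin has_derivative_matrix_inv[OF U(2)[OF that]]]
      by (simp add: matmul.minus_left matmul.minus_right)
    show "Ck_on k U (\<lambda>X. matrix_inv (A + B ** X) ** (- (B ** V)) ** matrix_inv (A + B ** X))" for V
      by (intro Ck_on_bilinear[OF matmul.bounded_bilinear_axioms] Ck_on_const U(1) Suc)
  qed
qed


section \<open>The Cayley chart\<close>

text \<open>This is the classical transform \<open>(1 - X) (1 + X)\<inverse>\<close>. The form chosen here contains \<open>X\<close> only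
  once, which makes smoothness immediate.\<close>
definition cayley :: "real^'n^'n \<Rightarrow> real^'n^'n" where
  "cayley X = 2 *\<^sub>R matrix_inv (mat 1 + X) - mat 1"

text \<open>The isometries, and the infinitesimal isometries, of the bilinear form \<open>K\<close> that lie in an
  algebra \<open>A\<close> of matrices. The second space is the Lie algebra of the first when \<open>K\<close> is
  nondegenerate.\<close>
definition isom_group :: "(real^'n^'n) set \<Rightarrow> real^'n^'n \<Rightarrow> (real^'n^'n) set" where
  "isom_group A K = {g \<in> A. transpose g ** K ** g = K}"

definition skew_algebra :: "(real^'n^'n) set \<Rightarrow> real^'n^'n \<Rightarrow> (real^'n^'n) set" where
  "skew_algebra A K = {X \<in> A. transpose X ** K + K ** X = 0}"

lemma cayley_mult:
  assumes "invertible (mat 1 + X)"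
  shows "(mat 1 + cayley X) ** (mat 1 + X) = 2 *\<^sub>R mat 1"
    and "cayley X ** (mat 1 + X) = mat 1 - X"
proof -
  have *: "(2 *\<^sub>R matrix_inv (mat 1 + X)) ** (mat 1 + X) = 2 *\<^sub>R mat 1"
    unfolding matmul.scaleR_left matrix_inv_left[OF assms] ..
  show "(mat 1 + cayley X) ** (mat 1 + X) = 2 *\<^sub>R mat 1"
    using * by (metis add.commute cayley_def diff_add_cancel)
  show "cayley X ** (mat 1 + X) = mat 1 - X"
    unfolding cayley_def matmul.diff_left * by (simp only: scaleR_2) simp
qed

lemma cayley_involution:
  assumes "invertible (mat 1 + X)"
  shows "invertible (mat 1 + cayley X)" "cayley (cayley X) = X"
proof -
  have *: "(mat 1 + cayley X) ** ((1/2) *\<^sub>R (mat 1 + X)) = mat 1"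
    using cayley_mult(1)[OF assms] by (simp add: matmul.scaleR_right)
  then show "invertible (mat 1 + cayley X)" by (auto simp: invertible_right_inverse)
  show "cayley (cayley X) = X"
    unfolding cayley_def[of "cayley X"] matrix_inv_eqI[OF *] by simp
qed

lemma matrix_left_cancel:
  "invertible (A::real^'n^'n) \<Longrightarrow> A ** X = A ** Y \<longleftrightarrow> X = Y"
  by (metis matrix_inv_left matrix_mul_assoc matrix_mul_lid)

lemma matrix_right_cancel:
  "invertible (A::real^'n^'n) \<Longrightarrow> X ** A = Y ** A \<longleftrightarrow> X = Y"
  by (metis matrix_inv_right matrix_mul_assoc matrix_mul_rid)

lemma transpose_add: "transpose (A + B) = transpose A + transpose (B::real^'n^'m)"
  and transpose_diff: "transpose (A - B) = transpose A - transpose (B::real^'n^'m)"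
  by (auto simp: transpose_def vec_eq_iff)

text \<open>Multiplying the isometry condition for \<open>g = cayley X\<close> by \<open>1 + X\<close> on the right and its transpose
  on the left clears the denominator, and turns it into
  \<open>(1 - X)\<^sup>T K (1 - X) = (1 + X)\<^sup>T K (1 + X)\<close>, in which only the terms linear in \<open>X\<close> survive.\<close>
lemma cayley_isometry_iff:
  assumes "invertible (mat 1 + X)"
  shows "transpose (cayley X) ** K ** cayley X = K \<longleftrightarrow> transpose X ** K + K ** X = 0"
proof -
  let ?Z = "mat 1 + X"
  have "transpose (cayley X) ** K ** cayley X = K \<longleftrightarrow>
      transpose ?Z ** (transpose (cayley X) ** K ** cayley X) ** ?Z = transpose ?Z ** K ** ?Z"
    using assms by (simp add: matrix_left_cancel matrix_right_cancel transpose_invertible)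
  also have "transpose ?Z ** (transpose (cayley X) ** K ** cayley X) ** ?Z =
      transpose (cayley X ** ?Z) ** K ** (cayley X ** ?Z)"
    by (simp add: matrix_transpose_mul matrix_mul_assoc)
  also have "\<dots> = transpose (mat 1 - X) ** K ** (mat 1 - X)"
    by (simp add: cayley_mult assms)
  also have "\<dots> = transpose ?Z ** K ** ?Z \<longleftrightarrow> 2 *\<^sub>R (transpose X ** K + K ** X) = 0"
    unfolding scaleR_2
    by (auto simp: transpose_add transpose_diff matmul.add_left matmul.add_right matmul.diff_left
        matmul.diff_right algebra_simps) 
  finally show ?thesis by simp
qed

locale matrix_algebra =
  fixes A :: "(real^'n^'n) set"
  assumes subspace: "subspace A" and one: "mat 1 \<in> A"
    and mult: "\<And>X Y. X \<in> A \<Longrightarrow> Y \<in> A \<Longrightarrow> X ** Y \<in> A"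
begin

text \<open>Left multiplication by an invertible element is injective on the algebra, hence by dimension
  onto, and so reaches the identity.\<close>
lemma inverse:
  assumes "X \<in> A" "invertible X"
  shows "matrix_inv X \<in> A"
proof -
  have lin: "linear ((**) X)" using matmul.bounded_linear_right bounded_linear.linear by blast
  have inj: "inj ((**) X)" using assms(2) by (auto simp: inj_def matrix_left_cancel)
  have sub: "(**) X ` A \<subseteq> A" using mult assms by auto
  have "dim ((**) X ` A) = dim A"
    by (rule dim_image_eq[OF lin]) (use inj in \<open>auto intro: inj_on_subset\<close>)
  then have "(**) X ` A = A"
    using subspace_dim_equal[OF linear_subspace_image[OF lin subspace] subspace sub] by simp
  then obtain Y where "Y \<in> A" "X ** Y = mat 1" using one by (metis imageE)
  then show ?thesis using matrix_inv_eqI by metis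
qed

lemma cayley: "X \<in> A \<Longrightarrow> invertible (mat 1 + X) \<Longrightarrow> cayley X \<in> A"
  unfolding cayley_def using subspace one by (intro subspace_diff subspace_mul inverse subspace_add)

lemma subspace_skew_algebra: "subspace (skew_algebra A K)"
proof (rule subspaceI)
  show "0 \<in> skew_algebra A K"
    using subspace_0[OF subspace] transpose_scalar[of 0 "0 :: real^'n^'n"]
    by (simp add: skew_algebra_def)
  show "X + Y \<in> skew_algebra A K" if "X \<in> skew_algebra A K" "Y \<in> skew_algebra A K" for X Y
    using that subspace_add[OF subspace]
    by (simp add: skew_algebra_def transpose_add matmul.add_left matmul.add_right)
      (metis (no_types, lifting) add.assoc add.commute add_0)
  show "c *\<^sub>R X \<in> skew_algebra A K" if "X \<in> skew_algebra A K" for c X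
    using that subspace_mul[OF subspace]
    by (simp add: skew_algebra_def transpose_scalar matmul.scaleR_left matmul.scaleR_right
        flip: scaleR_add_right)
qed

lemma cayley_image:
  assumes "U = {X. invertible (mat 1 + X)}"
  shows "cayley ` (U \<inter> isom_group A K) = U \<inter> skew_algebra A K"
proof -
  have 1: "cayley X \<in> U \<inter> skew_algebra A K" if "X \<in> U \<inter> isom_group A K" for X
  proof -
    have X: "invertible (mat 1 + X)" "X \<in> A" "transpose X ** K ** X = K"
      using that by (auto simp: assms isom_group_def)
    show ?thesis
      using X cayley_isometry_iff[OF cayley_involution(1)[OF X(1)], of K] cayley[OF X(2,1)]
      by (simp add: assms skew_algebra_def cayley_involution)
  qed
  have 2: "cayley X \<in> U \<inter> isom_group A K" if "X \<in> U \<inter> skew_algebra A K" for X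
    using that cayley_isometry_iff[of X K] cayley
    by (simp add: assms skew_algebra_def isom_group_def cayley_involution)
  show ?thesis
  proof (intro subset_antisym subsetI)
    show "Y \<in> cayley ` (U \<inter> isom_group A K)" if "Y \<in> U \<inter> skew_algebra A K" for Y
      using 2[OF that] cayley_involution(2)[of Y] that by (metis IntD1 assms imageI mem_Collect_eq)
  qed (use 1 in auto)
qed

lemma isom_group_invertible: "invertible K \<Longrightarrow> g \<in> isom_group A K \<Longrightarrow> invertible g"
  unfolding isom_group_def
  by (smt (verit) invertible_left_inverse matrix_inv_left matrix_mul_assoc mem_Collect_eq)

lemma isom_group_mult: "g \<in> isom_group A K \<Longrightarrow> h \<in> isom_group A K \<Longrightarrow> g ** h \<in> isom_group A K"
  unfolding isom_group_def using mult by (simp add: matrix_transpose_mul) (metis matrix_mul_assoc)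

lemma isom_group_inv:
  assumes "invertible K" "g \<in> isom_group A K"
  shows "matrix_inv g \<in> isom_group A K"
proof -
  have g: "invertible g" "g \<in> A" "transpose g ** K ** g = K"
    using assms isom_group_invertible by (auto simp: isom_group_def)
  have "transpose (matrix_inv g) ** K ** matrix_inv g =
      transpose (g ** matrix_inv g) ** K ** (g ** matrix_inv g)"
    by (subst g(3)[symmetric]) (simp add: matrix_transpose_mul matrix_mul_assoc)
  then show ?thesis using g inverse by (simp add: isom_group_def)
qed

text \<open>The Cayley transform is a slice chart around the identity: it is an involution of the open set
  where \<open>1 + X\<close> is invertible, stays inside the algebra, and exchanges isometries and
  infinitesimal isometries. Left translation moves it to any other point of the group.\<close>
theorem isom_group_lie_dim:
  assumes K: "invertible K"
  shows "has_lie_group_dim (isom_group A K) (dim (skew_algebra A K))"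
  unfolding has_lie_group_dim_def
proof
  show "GL_subgroup (isom_group A K)"
    using one isom_group_mult isom_group_inv[OF K] isom_group_invertible[OF K]
    by (auto simp: GL_subgroup_def GL_def) (simp add: isom_group_def)
  show "embedded_submanifold (dim (skew_algebra A K)) (isom_group A K)"
    unfolding embedded_submanifold_def
  proof
    fix p assume p: "p \<in> isom_group A K"
    have pinv: "invertible p" by (rule isom_group_invertible[OF K p])
    let ?q = "matrix_inv p"
    let ?V = "{X::real^'n^'n. invertible (mat 1 + X)}"
    let ?U = "{X. invertible (mat 1 + ?q ** X)}"
    let ?f = "\<lambda>X. cayley (?q ** X)" and ?g = "\<lambda>Y. p ** cayley Y"
    have pq [simp]: "p ** (?q ** X) = X" "?q ** (p ** X) = X" for X
      using pinv by (simp_all add: matrix_mul_assoc)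
    have aff: "continuous_on UNIV (\<lambda>X. mat 1 + B ** X)" for B :: "real^'n^'n"
      by (intro continuous_intros matmul.continuous_on)
    have "open {X. invertible (mat 1 + B ** X)}" for B :: "real^'n^'n"
      using open_vimage[OF open_invertible aff] by (simp add: vimage_def)
    from this[of ?q] this[of "mat 1"] have opn: "open ?U" "open ?V" by simp_all
    have smooth: "Ck_on k W (\<lambda>X. cayley (B ** X))"
      if "open W" "\<And>X. X \<in> W \<Longrightarrow> invertible (mat 1 + B ** X)"
      for B :: "real^'n^'n" and W k
      unfolding cayley_def diff_conv_add_uminus
      using that by (intro Ck_on_add Ck_on_bilinear[OF bounded_bilinear_scaleR] Ck_on_const
          Ck_on_matrix_inv_affine) auto
    have sf: "Ck_on k ?U ?f" for k by (intro smooth opn) auto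
    have sc: "Ck_on k ?V cayley" for k
      using smooth[OF opn(2), of "mat 1" k] by simp
    have sg: "Ck_on k ?V ?g" for k
      by (intro Ck_on_bilinear[OF matmul.bounded_bilinear_axioms] Ck_on_const opn sc)
    have hom: "homeomorphism ?U ?V ?f ?g"
    proof (rule homeomorphismI)
      show "continuous_on ?U ?f" "continuous_on ?V ?g" using sf[of 0] sg[of 0] by auto
    qed (auto simp: cayley_involution)
    have tr: "(\<lambda>X. ?q ** X) ` (?U \<inter> isom_group A K) = ?V \<inter> isom_group A K"
    proof (intro subset_antisym subsetI)
      fix Y assume "Y \<in> ?V \<inter> isom_group A K"
      then have "p ** Y \<in> ?U \<inter> isom_group A K" "Y = ?q ** (p ** Y)"
        using isom_group_mult[OF p] by auto
      then show "Y \<in> (\<lambda>X. ?q ** X) ` (?U \<inter> isom_group A K)" by blast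
    qed (use isom_group_mult[OF isom_group_inv[OF K p]] in auto)
    have "?f ` (?U \<inter> isom_group A K) = ?V \<inter> skew_algebra A K"
      using cayley_image[OF refl, of K] by (simp add: image_image flip: tr)
    moreover have "diffeomorphism ?U ?V ?f ?g"
      using opn hom sf sg by (simp add: diffeomorphism_def smooth_on_def)
    moreover have "p \<in> ?U"
    proof -
      have "(mat 1 + mat 1) ** ((1/2) *\<^sub>R mat 1) = (mat 1 :: real^'n^'n)"
        unfolding matmul.scaleR_right matrix_mul_rid by (rule scaleR_half_double)
      then show ?thesis using pinv by (auto simp: invertible_right_inverse)
    qed
    ultimately show "\<exists>U (V :: (real^'n^'n) set) f g W. p \<in> U \<and> diffeomorphism U V f g \<and> subspace W \<and>
        dim W = dim (skew_algebra A K) \<and> f ` (U \<inter> isom_group A K) = V \<inter> W"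
      by - (rule exI[of _ ?U], rule exI[of _ ?V], rule exI[of _ ?f], rule exI[of _ ?g],
          rule exI[of _ "skew_algebra A K"], intro conjI refl subspace_skew_algebra, assumption+)
  qed
qed

end

section \<open>Generic injectivity\<close>

definition matrix_unit :: "'n \<times> 'n \<Rightarrow> real^'n^'n" where
  "matrix_unit q = axis (fst q) (axis (snd q) 1)"

definition supported_on :: "('n \<times> 'n) set \<Rightarrow> (real^'n^'n) set" where
  "supported_on Q = {X. \<forall>i j. (i, j) \<notin> Q \<longrightarrow> X $ i $ j = 0}"

lemma subspace_supported_on: "subspace (supported_on Q)"
  by (auto simp: subspace_def supported_on_def)

lemma dim_supported_on:
  fixes Q :: "('n::finite \<times> 'n) set"
  shows "dim (supported_on Q) = card Q"
proof -
  have basis: "(Basis :: (real^'n^'n) set) = range matrix_unit"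
  proof (intro subset_antisym subsetI)
    fix u :: "real^'n^'n" assume "u \<in> Basis"
    then obtain i j where "u = axis i (axis j 1)" by (auto simp: Basis_vec_def)
    then have "u = matrix_unit (i, j)" by (simp add: matrix_unit_def)
    then show "u \<in> range matrix_unit" by blast
  qed (auto simp: matrix_unit_def axis_in_Basis_iff)
  have inj: "inj (matrix_unit :: 'n \<times> 'n \<Rightarrow> _)"
    by (auto simp: inj_def matrix_unit_def axis_eq_axis)
  have "X \<bullet> matrix_unit q = X $ fst q $ snd q" for X :: "real^'n^'n" and q
    by (simp add: matrix_unit_def inner_axis)
  then have "supported_on Q = {X. \<forall>u\<in>Basis. u \<notin> matrix_unit ` Q \<longrightarrow> X \<bullet> u = 0}"
    unfolding basis by (simp add: supported_on_def inj_image_mem_iff[OF inj])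
  also have "dim \<dots> = card (matrix_unit ` Q)"
    by (rule dim_substandard) (simp add: basis image_mono)
  also have "\<dots> = card Q"
    using inj by (auto intro: card_image inj_on_subset)
  finally show ?thesis .
qed

text \<open>The polynomial is the determinant of the matrix of \<open>F K\<close> in the basis of matrix units.\<close>
lemma injectivity_polynomial:
  fixes F :: "'a::real_normed_vector \<Rightarrow> real^'n^'n \<Rightarrow> real^'n^'n"
  assumes lin: "\<And>K. linear (F K)"
    and poly: "\<And>X i j. real_polynomial_function (\<lambda>K. F K X $ i $ j)"
  shows "\<exists>p. real_polynomial_function p \<and> (\<forall>K. p K \<noteq> 0 \<longleftrightarrow> inj (F K))"
proof -
  define M :: "'a \<Rightarrow> real^('n \<times> 'n)^('n \<times> 'n)" where
    "M = (\<lambda>K. \<chi> a b. F K (matrix_unit b) $ fst a $ snd a)"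
  have expand: "X = (\<Sum>b\<in>UNIV. X $ fst b $ snd b *\<^sub>R matrix_unit b)" for X :: "real^'n^'n"
  proof -
    have "(\<Sum>b\<in>UNIV. X $ fst b $ snd b *\<^sub>R matrix_unit b) $ i $ j = X $ i $ j" for i j
    proof -
      have "(\<Sum>b\<in>UNIV. X $ fst b $ snd b *\<^sub>R matrix_unit b) $ i $ j =
          (\<Sum>b\<in>UNIV. if b = (i, j) then X $ i $ j else 0)"
        unfolding sum_component by (rule sum.cong) (auto simp: matrix_unit_def axis_def)
      then show ?thesis by simp
    qed
    then show ?thesis by (simp add: vec_eq_iff)
  qed
  have M: "F K X $ i $ j = (M K *v (\<chi> b. X $ fst b $ snd b)) $ (i, j)" for K X i j
  proof -
    have "F K X $ i $ j = (\<Sum>b\<in>UNIV. X $ fst b $ snd b *\<^sub>R F K (matrix_unit b)) $ i $ j"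
      by (subst expand[of X]) (simp add: linear_sum[OF lin] linear_cmul[OF lin])
    then show ?thesis
      by (simp add: M_def matrix_vector_mult_def mult.commute)
  qed
  have "inj (F K) \<longleftrightarrow> det (M K) \<noteq> 0" for K
  proof -
    have "inj (F K) \<longleftrightarrow> (\<forall>X. F K X = 0 \<longrightarrow> X = 0)"
      by (rule linear_injective_0[OF lin])
    also have "\<dots> \<longleftrightarrow> (\<forall>x. M K *v x = 0 \<longrightarrow> x = 0)"
    proof safe
      fix x assume *: "\<forall>X. F K X = 0 \<longrightarrow> X = 0" "M K *v x = 0"
      have "(\<chi> b. (\<chi> i j. x $ (i, j)) $ fst b $ snd b) = x" by (simp add: vec_eq_iff)
      then have "F K (\<chi> i j. x $ (i, j)) = 0" using *(2) by (simp add: vec_eq_iff M)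
      then have "(\<chi> i j. x $ (i, j)) = 0" using *(1) by blast
      then show "x = 0" by (simp add: vec_eq_iff)
    next
      fix X assume *: "\<forall>x. M K *v x = 0 \<longrightarrow> x = 0" "F K X = 0"
      have "M K *v (\<chi> b. X $ fst b $ snd b) = 0"
        using *(2) M[of K X] by (simp add: vec_eq_iff)
      then have "(\<chi> b. X $ fst b $ snd b) = 0" using *(1) by blast
      then show "X = 0" by (simp add: vec_eq_iff)
    qed
    also have "\<dots> \<longleftrightarrow> det (M K) \<noteq> 0"
      using matrix_left_invertible_ker[of "M K"]
      by (simp add: invertible_left_inverse flip: invertible_det_nz)
    finally show ?thesis .
  qed
  moreover have "real_polynomial_function (\<lambda>K. det (M K))"
    unfolding det_def
    by (intro real_polynomial_function_sum real_polynomial_function.intros(4) real_polynomial_function_prod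
        real_polynomial_function.intros(2)) (auto simp: M_def poly)
  ultimately show ?thesis by auto
qed

lemma inner_matrix_mult:
  "(X::real^'n^'n) \<bullet> (A ** Y) = (transpose A ** X) \<bullet> Y"
proof -
  have "X \<bullet> (A ** Y) = (\<Sum>i\<in>UNIV. \<Sum>j\<in>UNIV. \<Sum>k\<in>UNIV. X $ i $ j * (A $ i $ k * Y $ k $ j))"
    by (simp add: inner_vec_def matrix_matrix_mult_def sum_distrib_left)
  also have "\<dots> = (\<Sum>i\<in>UNIV. \<Sum>k\<in>UNIV. \<Sum>j\<in>UNIV. X $ i $ j * (A $ i $ k * Y $ k $ j))"
    by (intro sum.cong refl sum.swap)
  also have "\<dots> = (\<Sum>k\<in>UNIV. \<Sum>i\<in>UNIV. \<Sum>j\<in>UNIV. X $ i $ j * (A $ i $ k * Y $ k $ j))"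
    by (rule sum.swap)
  also have "\<dots> = (\<Sum>k\<in>UNIV. \<Sum>j\<in>UNIV. \<Sum>i\<in>UNIV. X $ i $ j * (A $ i $ k * Y $ k $ j))"
    by (intro sum.cong refl sum.swap)
  also have "\<dots> = (transpose A ** X) \<bullet> Y"
    by (simp add: inner_vec_def matrix_matrix_mult_def sum_distrib_left sum_distrib_right
        transpose_def mult_ac)
  finally show ?thesis .
qed

lemma inner_transpose: "transpose (X::real^'n^'n) \<bullet> transpose Y = X \<bullet> Y"
  by (simp add: inner_vec_def transpose_def) (rule sum.swap)

definition restrict_matrix :: "('n \<times> 'n) set \<Rightarrow> real^'n^'n \<Rightarrow> real^'n^'n" where
  "restrict_matrix Q X = (\<chi> i j. if (i, j) \<in> Q then X $ i $ j else 0)"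

lemma linear_restrict_matrix: "linear (restrict_matrix Q)"
  by (auto simp: linear_iff restrict_matrix_def vec_eq_iff)

text \<open>Up to a positive factor in the first summand, and for symmetric \<open>K\<close>, this is \<open>T\<^sup>* T\<close> for the
  map \<open>T\<close> that sends \<open>X\<close> to the pair of \<open>X\<^sup>T K + K X\<close> and the entries of \<open>X\<close> in \<open>Q\<close>. So it is
  injective iff \<open>T\<close> is, and, unlike \<open>T\<close>, it is an endomorphism, with a determinant.\<close>
definition gram :: "('n::finite \<times> 'n) set \<Rightarrow> real^'n^'n \<Rightarrow> real^'n^'n \<Rightarrow> real^'n^'n" where
  "gram Q K X = K ** (transpose X ** K + K ** X) + restrict_matrix Q X"

lemma linear_gram: "linear (gram Q K)"
proof (rule linearI)
  show "gram Q K (X + Y) = gram Q K X + gram Q K Y" for X Y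
    by (simp add: gram_def linear_add[OF linear_restrict_matrix] transpose_add matmul.add_left
        matmul.add_right)
  show "gram Q K (c *\<^sub>R X) = c *\<^sub>R gram Q K X" for c X
    by (simp add: gram_def linear_cmul[OF linear_restrict_matrix] transpose_scalar matmul.scaleR_left
        matmul.scaleR_right flip: scaleR_add_right)
qed

lemma gram_polynomial:
  fixes Q :: "('n::finite \<times> 'n) set"
  shows "real_polynomial_function (\<lambda>K. gram Q K X $ i $ j)"
proof -
  have entry: "real_polynomial_function (\<lambda>K::real^'n^'n. K $ i $ j)" for i j :: 'n
    by (intro real_polynomial_function.intros(1) bounded_linear_compose[OF bounded_linear_vec_nth]
        bounded_linear_vec_nth)
  show ?thesis
    unfolding gram_def matrix_matrix_mult_def
    by (auto intro!: real_polynomial_function_sum real_polynomial_function.intros(4)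
        real_polynomial_function.intros(3) real_polynomial_function.intros(2) entry)
qed

text \<open>The inner product of \<open>X\<close> with its image is the sum of half the squared norm of
  \<open>X\<^sup>T L + L X\<close> and the squared norm of the restriction of \<open>X\<close>.\<close>
lemma gram_injective:
  assumes L: "transpose L = L"
    and "\<And>X. transpose X ** L + L ** X = 0 \<Longrightarrow> restrict_matrix Q X = 0 \<Longrightarrow> X = 0"
  shows "inj (gram Q L)"
proof (subst linear_injective_0[OF linear_gram], intro allI impI)
  fix X assume 0: "gram Q L X = 0"
  define S where "S = transpose X ** L + L ** X"
  have S: "transpose S = S" by (simp add: S_def transpose_add matrix_transpose_mul L)
  have "(transpose X ** L) \<bullet> S = (L ** X) \<bullet> S"
    using inner_transpose[of "L ** X" S] by (simp add: S matrix_transpose_mul L)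
  then have "S \<bullet> S = 2 * (X \<bullet> (L ** S))"
    by (subst (1) S_def) (simp add: inner_add_left inner_matrix_mult L)
  moreover have "X \<bullet> restrict_matrix Q X = restrict_matrix Q X \<bullet> restrict_matrix Q X"
    by (auto simp: inner_vec_def restrict_matrix_def intro!: sum.cong)
  moreover have "X \<bullet> gram Q L X = X \<bullet> (L ** S) + X \<bullet> restrict_matrix Q X"
    by (simp add: gram_def S_def inner_add_right)
  ultimately have "S \<bullet> S / 2 + restrict_matrix Q X \<bullet> restrict_matrix Q X = 0"
    using 0 by simp
  then have "S \<bullet> S = 0" "restrict_matrix Q X \<bullet> restrict_matrix Q X = 0"
    using inner_ge_zero[of S] inner_ge_zero[of "restrict_matrix Q X"] by linarith+
  then show "X = 0" using assms(2)[of X] by (simp add: S_def)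
qed

text \<open>On infinitesimal isometries the first summand of \<open>gram\<close> vanishes, and what remains is the
  restriction of \<open>X\<close> to the positions in \<open>Q\<close>, those outside \<open>R\<close> holding zeros. Injectivity
  thus means that the entries in \<open>Q\<close> determine \<open>X\<close>.\<close>
lemma dim_skew_algebra_le:
  assumes "inj (gram (Q \<union> - R) K)" "Q \<subseteq> R"
  shows "dim (skew_algebra (supported_on R) K) \<le> card Q"
proof -
  let ?A = "skew_algebra (supported_on R) K"
  have "gram (Q \<union> - R) K X \<in> supported_on Q" if "X \<in> ?A" for X
    using that assms(2) by (auto simp: skew_algebra_def gram_def supported_on_def restrict_matrix_def)
  moreover have "dim (gram (Q \<union> - R) K ` ?A) = dim ?A"
    by (rule dim_image_eq[OF linear_gram]) (use assms(1) in \<open>auto intro: inj_on_subset\<close>)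
  ultimately show ?thesis
    by (metis dim_subset dim_supported_on image_subsetI)
qed

section \<open>Comparability classes\<close>

definition cls :: "'v set set \<Rightarrow> 'v \<Rightarrow> 'v set" where
  "cls E i = vequiv E `` {i}"

text \<open>Summing over incomparable neighboring classes amounts to counting the vertices below, because
  distinct classes are either completely joined or not joined at all.\<close>
definition crossing :: "'v set set \<Rightarrow> 'v \<Rightarrow> 'v set" where
  "crossing E i = {j \<in> nbrs E i. \<not> vle E i j \<and> \<not> vle E j i}"

definition crossing_classes :: "'v set set \<Rightarrow> 'v set \<Rightarrow> 'v set set" where
  "crossing_classes E c = {d \<in> cnbrs E c. \<not> cle E c d \<and> \<not> cle E d c}"

text \<open>The direction is such that the matrices of the group are those supported on this relation: the
  entry \<open>(i, j)\<close> may be nonzero only if \<open>j \<preceq> i\<close>.\<close>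
definition order_rel :: "'v set set \<Rightarrow> ('v \<times> 'v) set" where
  "order_rel E = {(i, j). vle E j i}"

lemma vle_refl: "vle E i i" by (simp add: vle_def)

lemma vle_trans: "vle E i j \<Longrightarrow> vle E j k \<Longrightarrow> vle E i k" by (auto simp: vle_def)

lemma nbrs_sym: "j \<in> nbrs E i \<longleftrightarrow> i \<in> nbrs E j"
  by (simp add: nbrs_def insert_commute)

lemma in_cls_iff: "j \<in> cls E i \<longleftrightarrow> vle E i j \<and> vle E j i"
  by (simp add: cls_def vequiv_def)

lemma in_cls_self [simp]: "i \<in> cls E i" by (simp add: in_cls_iff vle_refl)

lemma cls_eq_iff: "cls E i = cls E j \<longleftrightarrow> vle E i j \<and> vle E j i"
  by (auto simp: set_eq_iff in_cls_iff intro: vle_refl vle_trans)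

lemma in_cls_iff_eq: "j \<in> cls E i \<longleftrightarrow> cls E j = cls E i"
  by (auto simp: in_cls_iff cls_eq_iff)

lemma vclasses_eq: "vclasses E = range (cls E)"
  by (auto simp: vclasses_def quotient_def cls_def)

lemma cle_iff: "cle E (cls E i) (cls E j) \<longleftrightarrow> vle E i j"
proof
  show "vle E i j" if "cle E (cls E i) (cls E j)"
    using that unfolding cle_def by (meson in_cls_iff vle_trans)
  show "cle E (cls E i) (cls E j)" if "vle E i j"
    using that unfolding cle_def by (meson in_cls_self)
qed

lemma nbrs_cls: "j \<in> nbrs E i \<Longrightarrow> cls E i \<noteq> cls E j \<Longrightarrow> cls E i' = cls E i \<Longrightarrow> cls E j' = cls E j
    \<Longrightarrow> j' \<in> nbrs E i'"
proof -
  have *: "j \<in> nbrs E i'" if "j \<in> nbrs E i" "cls E i \<noteq> cls E j" "cls E i' = cls E i" for i i' j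
    using that unfolding cls_eq_iff vle_def by auto
  show "j' \<in> nbrs E i'" if "j \<in> nbrs E i" "cls E i \<noteq> cls E j" "cls E i' = cls E i" "cls E j' = cls E j"
    using * that by (metis nbrs_sym)
qed

lemma crossing_classes_iff:
  "cls E j \<in> crossing_classes E (cls E i) \<longleftrightarrow> j \<in> crossing E i"
proof -
  have "cls E j \<in> cnbrs E (cls E i) \<longleftrightarrow> cls E j \<noteq> cls E i \<and> j \<in> nbrs E i"
    unfolding cnbrs_def vclasses_eq
    using nbrs_cls[of _ E _ i j] in_cls_self[of i E] in_cls_self[of j E]
    by (auto simp: in_cls_iff_eq nbrs_def)
  then show ?thesis
    by (auto simp: crossing_classes_def crossing_def cle_iff cls_eq_iff)
qed

lemma Union_crossing_classes: "\<Union> (crossing_classes E (cls E i)) = crossing E i"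
proof (intro subset_antisym subsetI)
  fix j assume "j \<in> \<Union> (crossing_classes E (cls E i))"
  then obtain d where d: "d \<in> crossing_classes E (cls E i)" "j \<in> d" by blast
  then have "d \<in> vclasses E" by (simp add: crossing_classes_def cnbrs_def)
  then have "d = cls E j" using d(2) by (auto simp: vclasses_eq in_cls_iff_eq)
  then show "j \<in> crossing E i" using d(1) by (simp add: crossing_classes_iff)
next
  fix j assume "j \<in> crossing E i"
  then have "cls E j \<in> crossing_classes E (cls E i)" by (simp add: crossing_classes_iff)
  then show "j \<in> \<Union> (crossing_classes E (cls E i))" by (metis UnionI in_cls_self)
qed

lemma classes_disjoint: "c \<in> range (cls E) \<Longrightarrow> d \<in> range (cls E) \<Longrightarrow> c \<noteq> d \<Longrightarrow> c \<inter> d = {}"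
  by (auto simp: in_cls_iff_eq)

lemma crossing_classes_subset: "crossing_classes E c \<subseteq> range (cls E)"
  by (auto simp: crossing_classes_def cnbrs_def vclasses_eq)

lemma card_Union_classes:
  fixes D :: "'v::finite set set"
  assumes "D \<subseteq> range (cls E)"
  shows "card (\<Union> D) = sum card D"
proof (rule card_Union_disjoint)
  show "pairwise disjnt D"
    unfolding pairwise_def disjnt_def
  proof (intro ballI impI)
    fix c d assume "c \<in> D" "d \<in> D" "c \<noteq> d"
    then show "c \<inter> d = {}" using assms by (intro classes_disjoint[of c E d]) auto
  qed
qed auto

lemma excess_cls:
  fixes E :: "'v::finite set set"
  shows "excess E (cls E i) = card (cls E i) - card (crossing E i)"
  unfolding excess_def crossing_classes_def[symmetric]
  by (simp add: card_Union_classes[OF crossing_classes_subset] nat_diff_distrib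
      flip: Union_crossing_classes of_nat_sum)

text \<open>The positions above the diagonal, for an arbitrary enumeration of the vertices, in the blocks
  of \<open>S\<close> cut out by the classes: a skew matrix with these blocks is given by its entries there.\<close>
definition pair_set :: "'v::finite set set \<Rightarrow> 'v set \<Rightarrow> ('v \<times> 'v) set" where
  "pair_set E S = {(i, j). i \<in> S \<and> j \<in> S \<and> cls E i = cls E j \<and> to_nat i < to_nat j}"

lemma card_ordered_pairs:
  fixes h :: "'a \<Rightarrow> nat"
  assumes "finite T" "inj h"
  shows "card {(i, j). i \<in> T \<and> j \<in> T \<and> h i < h j} = card T choose 2"
proof -
  have "bij_betw (\<lambda>(i, j). {i, j}) {(i, j). i \<in> T \<and> j \<in> T \<and> h i < h j} {B. B \<subseteq> T \<and> card B = 2}"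
  proof (rule bij_betw_imageI)
    show "inj_on (\<lambda>(i, j). {i, j}) {(i, j). i \<in> T \<and> j \<in> T \<and> h i < h j}"
      by (auto simp: inj_on_def doubleton_eq_iff)
    show "(\<lambda>(i, j). {i, j}) ` {(i, j). i \<in> T \<and> j \<in> T \<and> h i < h j} = {B. B \<subseteq> T \<and> card B = 2}"
    proof (intro subset_antisym subsetI)
      fix B assume "B \<in> {B. B \<subseteq> T \<and> card B = 2}"
      then obtain i j where ij: "B = {i, j}" "i \<noteq> j" "i \<in> T" "j \<in> T" by (auto simp: card_2_iff)
      then have "h i < h j \<or> h j < h i" using assms(2) by (metis injD linorder_neqE_nat)
      then show "B \<in> (\<lambda>(i, j). {i, j}) ` {(i, j). i \<in> T \<and> j \<in> T \<and> h i < h j}"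
        using ij by (auto simp: image_iff insert_commute)
    qed (auto simp: card_2_iff)
  qed
  then show ?thesis using n_subsets[OF assms(1)] by (simp add: bij_betw_same_card)
qed

lemma card_pair_set:
  fixes E :: "'v::finite set set"
  shows "card (pair_set E S) = (\<Sum>c\<in>vclasses E. card (S \<inter> c) choose 2)"
proof -
  let ?P = "\<lambda>c. {(i, j). i \<in> S \<inter> c \<and> j \<in> S \<inter> c \<and> to_nat i < to_nat j}"
  have "pair_set E S = (\<Union>c\<in>vclasses E. ?P c)"
    by (auto simp: pair_set_def vclasses_eq in_cls_iff_eq)
  moreover have "disjoint_family_on ?P (vclasses E)"
    by (auto simp: disjoint_family_on_def vclasses_eq in_cls_iff_eq)
  ultimately have "card (pair_set E S) = (\<Sum>c\<in>vclasses E. card (?P c))"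
    by (simp add: card_UN_disjoint' )
  also have "\<dots> = (\<Sum>c\<in>vclasses E. card (S \<inter> c) choose 2)"
    by (intro sum.cong refl card_ordered_pairs) auto
  finally show ?thesis .
qed

section \<open>The lower bound\<close>

text \<open>For positive definite \<open>K\<close>, let \<open>W\<close> assign to each class the \<open>K\<close>-orthogonal complement of the
  span of the coordinate vectors strictly above it in the span of those in it or above it. The core
  is the part of \<open>W (cls E i)\<close> that is orthogonal to the spaces of all other classes. Every bivector
  on it gives an infinitesimal isometry in the algebra.\<close>
definition core :: "'v set set \<Rightarrow> real^'v^'v \<Rightarrow> 'v::finite \<Rightarrow> (real^'v) set" where
  "core E K i = {u. (\<forall>k. \<not> vle E i k \<longrightarrow> u $ k = 0) \<and> (\<forall>j. \<not> vle E j i \<longrightarrow> (K *v u) $ j = 0)}"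

lemma subspace_core: "subspace (core E K i)"
  by (auto simp: subspace_def core_def matrix_vector_right_distrib matrix_vector_mult_scaleR)

lemma core_cong: "cls E i = cls E j \<Longrightarrow> core E K i = core E K j"
  unfolding core_def cls_eq_iff by (metis vle_trans)

lemma sym_space_nbrs: "K \<in> sym_space E \<Longrightarrow> K $ i $ j \<noteq> 0 \<Longrightarrow> j \<in> nbrs E i \<union> {i}"
  by (cases "i = j"; cases "{i, j} \<in> E") (simp_all add: sym_space_def nbrs_def)

text \<open>There are \<open>card (cls E i)\<close> more coordinates \<open>k\<close> with \<open>i \<preceq> k\<close> than coordinates strictly
  above \<open>i\<close>. Of the equations \<open>(K u)\<^sub>j = 0\<close>, those with \<open>j\<close> outside the closed neighborhood
  of \<open>i\<close> hold by themselves, since a vertex above \<open>i\<close> has no neighbors outside it. The others belong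
  to the vertices strictly above \<open>i\<close>, all of which are neighbors, and to the crossing ones.\<close>
lemma dim_core:
  fixes E :: "'v::finite set set"
  assumes K: "K \<in> sym_space E"
  shows "card (cls E i) \<le> dim (core E K i) + card (crossing E i)"
proof -
  let ?N = "nbrs E i \<union> {i}"
  let ?S = "{k. \<not> vle E i k}" and ?C = "{j \<in> ?N. \<not> vle E j i}"
  define T where "T = (\<lambda>k. axis k 1 :: real^'v) ` ?S \<union> (\<lambda>j. K $ j) ` ?C"
  have "core E K i = {y \<in> UNIV. \<forall>x\<in>span T. orthogonal x y}"
  proof -
    have far: "(K *v u) $ j = 0" if u: "\<forall>k. \<not> vle E i k \<longrightarrow> u $ k = 0" and j: "j \<notin> ?N" for u j
    proof -
      have "K $ j $ k * u $ k = 0" for k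
        using u j sym_space_nbrs[OF K, of j k] nbrs_sym[of k E j] by (fastforce simp: vle_def)
      then show ?thesis by (auto simp: matrix_vector_mult_def intro!: sum.neutral)
    qed
    have "(\<forall>x\<in>span T. orthogonal x u) \<longleftrightarrow> (\<forall>x\<in>T. orthogonal u x)" for u
      using orthogonal_to_span[of _ T u] by (auto simp: orthogonal_commute intro: span_base)
    also have "\<dots> u \<longleftrightarrow> (\<forall>k. \<not> vle E i k \<longrightarrow> u $ k = 0) \<and>
        (\<forall>j\<in>?C. (K *v u) $ j = 0)" for u
      by (auto simp: T_def ball_Un orthogonal_def inner_axis matrix_vector_mul_component inner_commute)
    finally show ?thesis unfolding core_def using far by blast
  qed
  then have "dim (core E K i) + dim (span T) = CARD('v)"
    using dim_subspace_orthogonal_to_vectors[of "span T" "UNIV :: (real^'v) set"] by simp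
  moreover have "dim (span T) \<le> card T"
    using dim_le_card[of "span T" T] by (simp add: T_def)
  moreover have "card T \<le> card ?S + card ?C"
    unfolding T_def by (meson card_Un_le card_image_le finite add_mono order_trans)
  moreover have "card ?S + card (cls E i) + card {k. vle E i k \<and> \<not> vle E k i} = CARD('v)"
  proof -
    have "UNIV = ?S \<union> (cls E i \<union> {k. vle E i k \<and> \<not> vle E k i})" by (auto simp: in_cls_iff)
    moreover have "card (?S \<union> (cls E i \<union> {k. vle E i k \<and> \<not> vle E k i})) =
        card ?S + (card (cls E i) + card {k. vle E i k \<and> \<not> vle E k i})"
      by (subst card_Un_disjoint, (auto simp: in_cls_iff)[3], subst card_Un_disjoint)
        (auto simp: in_cls_iff)
    ultimately show ?thesis by simp
  qed
  moreover have "card ?C = card (crossing E i) + card {k. vle E i k \<and> \<not> vle E k i}"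
  proof -
    have "?C = crossing E i \<union> {k. vle E i k \<and> \<not> vle E k i}"
      by (auto simp: crossing_def vle_def)
    moreover have "crossing E i \<inter> {k. vle E i k \<and> \<not> vle E k i} = {}" by (auto simp: crossing_def)
    ultimately show ?thesis by (simp add: card_Un_disjoint)
  qed
  ultimately show ?thesis by linarith
qed

lemma symmetric_inner: "transpose K = K \<Longrightarrow> (x::real^'n) \<bullet> (K *v y) = y \<bullet> (K *v x)"
  by (metis dot_lmul_matrix inner_commute transpose_matrix_vector)

lemma core_orthogonal:
  assumes "transpose K = K" "cls E i \<noteq> cls E j" "u \<in> core E K i" "w \<in> core E K j"
  shows "w \<bullet> (K *v u) = 0"
proof -
  have *: "w \<bullet> (K *v u) = 0" if "\<not> vle E j i" "u \<in> core E K i" "w \<in> core E K j" for i j u w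
  proof -
    have "w $ k * (K *v u) $ k = 0" for k
      using that vle_trans[of E j k i] by (auto simp: core_def)
    then show ?thesis by (auto simp: inner_vec_def intro!: sum.neutral)
  qed
  show ?thesis
    using *[of j i u w] *[of i j w u] assms symmetric_inner[OF assms(1), of w u]
    by (auto simp: cls_eq_iff)
qed

lemma independent_family_exists:
  fixes V :: "'a::euclidean_space set"
  assumes "finite T" "card T \<le> dim V"
  shows "\<exists>f. (\<forall>i\<in>T. f i \<in> V) \<and> (\<forall>x. (\<Sum>i\<in>T. x i *\<^sub>R f i) = 0 \<longrightarrow> (\<forall>i\<in>T. x i = 0))"
proof -
  obtain B where B: "B \<subseteq> V" "independent B" "card B = dim V"
    using basis_exists by metis
  have fin: "finite B" using B(2) by (rule independent_imp_finite)
  obtain f where f: "f ` T \<subseteq> B" "inj_on f T"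
    using card_le_inj[OF assms(1) fin] assms(2) B(3) by auto
  have "x i = 0" if "(\<Sum>i\<in>T. x i *\<^sub>R f i) = 0" "i \<in> T" for x :: "_ \<Rightarrow> real" and i
  proof -
    have "(\<Sum>v\<in>f ` T. x (inv_into T f v) *\<^sub>R v) = (\<Sum>i\<in>T. x i *\<^sub>R f i)"
      using f(2) by (subst sum.reindex) (auto intro!: sum.cong)
    then have "x (inv_into T f (f i)) = 0"
      using independentD[OF B(2), of "f ` T" "\<lambda>v. x (inv_into T f v)" "f i"] that f(1) assms(1)
      by simp
    then show ?thesis using f(2) that(2) by simp
  qed
  then show ?thesis using f(1) B(1) by blast
qed

text \<open>Cores of distinct classes are \<open>K\<close>-orthogonal, so independence can be tested in each class
  separately.\<close>
lemma core_family:
  fixes E :: "'v::finite set set"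
  assumes K: "pos_def K" and S: "\<And>i. card (S \<inter> cls E i) \<le> dim (core E K i)"
  shows "\<exists>u. (\<forall>i\<in>S. u i \<in> core E K i) \<and> (\<forall>x. (\<Sum>i\<in>S. x i *\<^sub>R u i) = 0 \<longrightarrow> (\<forall>i\<in>S. x i = 0))"
proof -
  have "\<forall>c. \<exists>f. \<forall>a. c = cls E a \<longrightarrow> (\<forall>i\<in>S \<inter> c. f i \<in> core E K a) \<and>
      (\<forall>x. (\<Sum>i\<in>S \<inter> c. x i *\<^sub>R f i) = 0 \<longrightarrow> (\<forall>i\<in>S \<inter> c. x i = 0))"
  proof
    fix c
    show "\<exists>f. \<forall>a. c = cls E a \<longrightarrow> (\<forall>i\<in>S \<inter> c. f i \<in> core E K a) \<and>
      (\<forall>x. (\<Sum>i\<in>S \<inter> c. x i *\<^sub>R f i) = 0 \<longrightarrow> (\<forall>i\<in>S \<inter> c. x i = 0))"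
    proof (cases "\<exists>a. c = cls E a")
      case True
      then obtain a where a: "c = cls E a" by blast
      have "\<forall>b. c = cls E b \<longrightarrow> core E K b = core E K a" using a core_cong by metis
      moreover obtain f where "(\<forall>i\<in>S \<inter> c. f i \<in> core E K a) \<and>
          (\<forall>x. (\<Sum>i\<in>S \<inter> c. x i *\<^sub>R f i) = 0 \<longrightarrow> (\<forall>i\<in>S \<inter> c. x i = 0))"
        using independent_family_exists[OF _ S[of a]] unfolding a by auto
      ultimately show ?thesis by (intro exI[of _ f]) simp
    qed auto
  qed
  from choice[OF this] obtain f where F: "\<forall>c. \<forall>a. c = cls E a \<longrightarrow> (\<forall>i\<in>S \<inter> c. f c i \<in> core E K a) \<and>
      (\<forall>x. (\<Sum>i\<in>S \<inter> c. x i *\<^sub>R f c i) = 0 \<longrightarrow> (\<forall>i\<in>S \<inter> c. x i = 0))" ..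
  have f: "i \<in> S \<inter> cls E a \<Longrightarrow> f (cls E a) i \<in> core E K a"
    "(\<Sum>i\<in>S \<inter> cls E a. x i *\<^sub>R f (cls E a) i) = 0 \<Longrightarrow> i \<in> S \<inter> cls E a \<Longrightarrow> x i = 0" for a x i
    using spec[OF F, of "cls E a"] by blast+
  define u where "u i = f (cls E i) i" for i
  have "x a = 0" if sum0: "(\<Sum>i\<in>S. x i *\<^sub>R u i) = 0" and a: "a \<in> S" for x :: "'v \<Rightarrow> real" and a
  proof -
    define w where "w c = (\<Sum>i\<in>S \<inter> c. x i *\<^sub>R f c i)" for c
    have w: "w (cls E i) \<in> core E K i" for i
      unfolding w_def by (intro subspace_sum subspace_mul subspace_core f(1))
    have "(\<Sum>i\<in>S. x i *\<^sub>R u i) = (\<Sum>c\<in>range (cls E). \<Sum>i\<in>{i\<in>S. cls E i = c}. x i *\<^sub>R u i)"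
      by (rule sum.group[symmetric]) auto
    also have "\<dots> = (\<Sum>c\<in>range (cls E). w c)"
      unfolding w_def
    proof (intro sum.cong refl)
      fix c assume "c \<in> range (cls E)"
      then obtain b where b: "c = cls E b" by blast
      have iff: "i \<in> c \<longleftrightarrow> cls E i = c" for i unfolding b by (rule in_cls_iff_eq)
      then show "{i \<in> S. cls E i = c} = S \<inter> c" by blast
      show "x i *\<^sub>R u i = x i *\<^sub>R f c i" if "i \<in> S \<inter> c" for i
        using that iff by (simp add: u_def)
    qed
    finally have "0 = (\<Sum>c\<in>range (cls E). w c) \<bullet> (K *v w (cls E a))" using sum0 by simp
    also have "\<dots> = (\<Sum>c\<in>range (cls E). if c = cls E a then w c \<bullet> (K *v w c) else 0)"
      unfolding inner_sum_left
    proof (rule sum.cong)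
      fix c assume "c \<in> range (cls E)"
      then obtain b where "c = cls E b" by blast
      then show "w c \<bullet> (K *v w (cls E a)) = (if c = cls E a then w c \<bullet> (K *v w c) else 0)"
        using core_orthogonal[OF _ _ w[of a] w[of b]] K by (auto simp: pos_def_def)
    qed simp
    also have "\<dots> = w (cls E a) \<bullet> (K *v w (cls E a))" by simp
    finally have "w (cls E a) = 0" using K unfolding pos_def_def by force
    then show ?thesis using f(2)[where a = a and i = a and x = x] a by (simp add: w_def)
  qed
  then show ?thesis using f(1) by (intro exI[of _ u]) (auto simp: u_def)
qed

lemma pos_def_invertible: "pos_def K \<Longrightarrow> invertible K"
  using matrix_left_invertible_ker[of K]
  by (auto simp: invertible_left_inverse pos_def_def)

text \<open>With independent core vectors as the columns of \<open>P\<close>, each skew matrix \<open>\<Lambda>\<close> with the blocks of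
  \<open>S\<close> gives the infinitesimal isometry \<open>P \<Lambda> P\<^sup>T K\<close>: multiplied by \<open>K\<close> on the left it is visibly
  skew, and it lies in the algebra because \<open>u\<^sub>i\<close> pairs nontrivially with \<open>e\<^sub>j\<close> only if
  \<open>j \<preceq> i\<close>, whereas \<open>u\<^sub>k\<close>, for \<open>k\<close> in the class of \<open>i\<close>, involves only vertices above \<open>i\<close>.
  It depends injectively on \<open>\<Lambda>\<close> since \<open>P\<close> is injective on vectors supported on \<open>S\<close>.\<close>
lemma pair_set_le_dim:
  fixes E :: "'v::finite set set"
  assumes K: "pos_def K" and S: "\<And>i. card (S \<inter> cls E i) \<le> dim (core E K i)"
  shows "card (pair_set E S) \<le> dim (skew_algebra (supported_on (order_rel E)) K)"
proof -
  have sym: "transpose K = K" using K by (simp add: pos_def_def)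
  obtain u where u: "\<And>i. i \<in> S \<Longrightarrow> u i \<in> core E K i"
    "\<And>x i. (\<Sum>i\<in>S. x i *\<^sub>R u i) = 0 \<Longrightarrow> i \<in> S \<Longrightarrow> x i = (0::real)"
    using core_family[OF assms] by blast
  define P :: "real^'v^'v" where "P = (\<chi> k i. if i \<in> S then u i $ k else 0)"
  define \<Phi> where "\<Phi> \<mu> = P ** (\<mu> - transpose \<mu>) ** transpose P ** K" for \<mu>
  have P0: "M = 0" if "P ** M = 0" "\<And>i j. i \<notin> S \<Longrightarrow> M $ i $ j = 0" for M :: "real^'v^'v"
  proof -
    have "(\<Sum>i\<in>S. M $ i $ j *\<^sub>R u i) = 0" for j
    proof (subst vec_eq_iff, intro allI)
      fix k
      have "(\<Sum>i\<in>S. M $ i $ j *\<^sub>R u i) $ k = (\<Sum>i\<in>UNIV. P $ k $ i * M $ i $ j)"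
        by (auto simp: P_def sum_component mult.commute intro!: sum.mono_neutral_cong_left)
      then show "(\<Sum>i\<in>S. M $ i $ j *\<^sub>R u i) $ k = 0 $ k"
        using that(1) by (simp add: matrix_matrix_mult_def vec_eq_iff)
    qed
    then have "M $ i $ j = 0" if "i \<in> S" for i j
      using u(2)[where x = "\<lambda>i. M $ i $ j"] that by blast
    then show ?thesis using that(2) by (simp add: vec_eq_iff) blast
  qed
  have lin: "linear \<Phi>"
    unfolding \<Phi>_def
    by (rule linearI) (simp_all add: transpose_add transpose_scalar matmul.add_left matmul.add_right
        matmul.diff_left matmul.diff_right matmul.scaleR_left matmul.scaleR_right algebra_simps)
  have image: "\<Phi> \<mu> \<in> skew_algebra (supported_on (order_rel E)) K"
    if mu: "\<mu> \<in> supported_on (pair_set E S)" for \<mu>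
  proof -
    define \<Lambda> where "\<Lambda> = \<mu> - transpose \<mu>"
    have skew: "transpose \<Lambda> = - \<Lambda>" by (simp add: \<Lambda>_def transpose_diff)
    have PK: "(transpose P ** K) $ i $ j = (if i \<in> S then (K *v u i) $ j else 0)" for i j
    proof -
      have "K $ k $ j = K $ j $ k" for k by (metis sym transpose_def vec_lambda_beta)
      then show ?thesis
        by (auto simp: P_def transpose_def matrix_matrix_mult_def matrix_vector_mult_def mult.commute)
    qed
    have "\<Phi> \<mu> $ l $ j = 0" if "\<not> vle E j l" for l j
    proof -
      have "P $ l $ k * (\<Lambda> $ k $ i * (transpose P ** K) $ i $ j) = 0" for k i
      proof (rule ccontr)
        assume nz: "\<not> ?thesis"
        then have "k \<in> S" "u k $ l \<noteq> 0" by (auto simp: P_def split: if_splits)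
        moreover from nz have "i \<in> S" "(K *v u i) $ j \<noteq> 0" by (auto simp: PK split: if_splits)
        ultimately have "vle E k l" "vle E j i" using u(1) by (auto simp: core_def)
        moreover have "cls E k = cls E i"
        proof -
          from nz have "\<mu> $ k $ i \<noteq> 0 \<or> \<mu> $ i $ k \<noteq> 0" by (auto simp: \<Lambda>_def transpose_def)
          then have "(k, i) \<in> pair_set E S \<or> (i, k) \<in> pair_set E S"
            using mu unfolding supported_on_def by blast
          then show ?thesis by (auto simp: pair_set_def)
        qed
        ultimately show False using that by (meson vle_trans cls_eq_iff)
      qed
      then have "(P ** (\<Lambda> ** (transpose P ** K))) $ l $ j = 0"
        by (auto simp: matrix_matrix_mult_def[of P] matrix_matrix_mult_def[of \<Lambda>] sum_distrib_left
            intro!: sum.neutral)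
      then show ?thesis by (simp add: \<Phi>_def \<Lambda>_def matrix_mul_assoc)
    qed
    moreover have "transpose (\<Phi> \<mu>) ** K + K ** \<Phi> \<mu> = 0"
      unfolding \<Phi>_def \<Lambda>_def[symmetric]
      by (simp add: matrix_transpose_mul sym skew matmul.minus_left matmul.minus_right matrix_mul_assoc)
    ultimately show ?thesis by (simp add: skew_algebra_def supported_on_def order_rel_def)
  qed
  have "\<mu> = 0" if mu: "\<mu> \<in> supported_on (pair_set E S)" and 0: "\<Phi> \<mu> = 0" for \<mu>
  proof -
    define \<Lambda> where "\<Lambda> = \<mu> - transpose \<mu>"
    have supp: "\<Lambda> $ i $ j = 0" if "i \<notin> S \<or> j \<notin> S" for i j
      using mu that by (auto simp: \<Lambda>_def transpose_def supported_on_def pair_set_def)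
    have "P ** (\<Lambda> ** transpose P) ** K = 0 ** K" using 0 by (simp add: \<Phi>_def \<Lambda>_def matrix_mul_assoc)
    then have "P ** (\<Lambda> ** transpose P) = 0"
      using matrix_right_cancel[OF pos_def_invertible[OF K]] by blast
    then have "\<Lambda> ** transpose P = 0"
      by (rule P0) (simp add: matrix_matrix_mult_def supp)
    then have "P ** transpose \<Lambda> = transpose 0" by (metis matrix_transpose_mul transpose_transpose)
    also have "transpose 0 = (0 :: real^'v^'v)" by (simp add: transpose_def vec_eq_iff)
    finally have "transpose \<Lambda> = 0" by (rule P0) (simp add: transpose_def supp)
    then have L0: "\<mu> $ i $ j = \<mu> $ j $ i" for i j
      by (auto simp: \<Lambda>_def transpose_def vec_eq_iff)
    have "\<mu> $ i $ j = 0" for i j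
    proof (cases "(i, j) \<in> pair_set E S")
      case True
      then have "(j, i) \<notin> pair_set E S" by (auto simp: pair_set_def)
      then have "\<mu> $ j $ i = 0" using mu unfolding supported_on_def by blast
      then show ?thesis using L0[of i j] by simp
    qed (use mu in \<open>auto simp: supported_on_def\<close>)
    then show ?thesis by (simp add: vec_eq_iff)
  qed
  then have "inj_on \<Phi> (supported_on (pair_set E S))"
    using linear_injective_on_subspace_0[OF lin subspace_supported_on] by blast
  then have "dim (\<Phi> ` supported_on (pair_set E S)) = card (pair_set E S)"
    using dim_image_eq[OF lin] subspace_supported_on by (metis dim_supported_on span_eq_iff)
  then show ?thesis using image by (metis dim_subset image_subsetI)
qed

section \<open>A form with few infinitesimal symmetries\<close>

text \<open>Treat the sets in \<open>D\<close> one after the other, and let each cover as much as it can of what the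
  images so far have missed of \<open>c\<close>.\<close>
lemma spreading_map_exists:
  assumes "finite D" "finite c" "pairwise disjnt D" "\<And>d. d \<in> D \<Longrightarrow> finite d \<and> card d \<le> card c"
  shows "\<exists>b. (\<forall>d\<in>D. inj_on b d \<and> b ` d \<subseteq> c) \<and> card (b ` \<Union>D) = min (card c) (sum card D)"
  using assms(1,3,4)
proof (induction D rule: finite_induct)
  case empty
  then show ?case by simp
next
  case (insert d D)
  obtain b where b: "\<And>e. e \<in> D \<Longrightarrow> inj_on b e \<and> b ` e \<subseteq> c"
    "card (b ` \<Union>D) = min (card c) (sum card D)"
  proof -
    have "\<exists>b. (\<forall>d\<in>D. inj_on b d \<and> b ` d \<subseteq> c) \<and> card (b ` \<Union>D) = min (card c) (sum card D)"
      using insert.prems by (intro insert.IH) (auto simp: pairwise_insert)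
    then show ?thesis using that by blast
  qed
  let ?I = "b ` \<Union>D"
  have d: "finite d" "card d \<le> card c" using insert.prems(2)[of d] by simp_all
  have I: "?I \<subseteq> c" using b(1) by blast
  have finI: "finite ?I" using I assms(2) by (rule finite_subset)
  have "\<exists>J. J \<subseteq> c \<and> card J = card d \<and> card (?I \<union> J) = min (card c) (sum card D + card d)"
  proof (cases "card d \<le> card (c - ?I)")
    case True
    then obtain J where J: "J \<subseteq> c - ?I" "card J = card d"
      using obtain_subset_with_card_n by metis
    have "card (?I \<union> J) = card ?I + card J"
      using J(1) finI assms(2) by (intro card_Un_disjoint) (auto intro: finite_subset)
    moreover have "card (c - ?I) = card c - card ?I" using finI I by (rule card_Diff_subset)
    ultimately show ?thesis using J True b(2) by (intro exI[of _ J]) auto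
  next
    case False
    then obtain J where J: "c - ?I \<subseteq> J" "J \<subseteq> c" "card J = card d"
      using exists_subset_between[of "c - ?I" "card d" c] d(2) assms(2) by auto
    then have "?I \<union> J = c" using I by blast
    moreover have "card (c - ?I) = card c - card ?I" using finI I by (rule card_Diff_subset)
    ultimately show ?thesis using J False b(2) by (intro exI[of _ J]) auto
  qed
  then obtain J where J: "J \<subseteq> c" "card J = card d" "card (?I \<union> J) = min (card c) (sum card D + card d)"
    by blast
  obtain f where f: "bij_betw f d J"
    using finite_same_card_bij[of d J] d(1) J assms(2) finite_subset by metis
  define g where "g x = (if x \<in> d then f x else b x)" for x
  have out: "x \<notin> d" if "x \<in> e" "e \<in> D" for x e
    using insert.prems(1) insert.hyps(2) that by (auto simp: pairwise_insert disjnt_def)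
  have "g ` d = J" using f by (auto simp: g_def bij_betw_def)
  moreover have "g ` \<Union>D = ?I" using out by (auto simp: g_def image_def)
  ultimately have "card (g ` \<Union>(insert d D)) = min (card c) (sum card (insert d D))"
    using J(3) insert.hyps by (simp add: image_Un Un_commute add.commute)
  moreover have "inj_on g d \<and> g ` d \<subseteq> c"
    using f J(1) by (auto simp: g_def bij_betw_def inj_on_def)
  moreover have "inj_on g e \<and> g ` e \<subseteq> c" if "e \<in> D" for e
    using b(1)[OF that] out[OF _ that] by (auto simp: g_def inj_on_def)
  ultimately show ?case by (intro exI[of _ g]) auto
qed

lemma crossing_sym: "j \<in> crossing E i \<longleftrightarrow> i \<in> crossing E j"
  by (auto simp: crossing_def nbrs_sym)

lemma inner_eq_0I: "(\<And>k. x $ k = 0 \<or> y $ k = 0) \<Longrightarrow> (x::real^'n) \<bullet> y = 0"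
  by (auto simp: inner_vec_def intro!: sum.neutral)

lemma pos_def_shift:
  fixes B :: "real^'n^'n"
  assumes "transpose B = B"
  shows "\<exists>t>0. pos_def (t *\<^sub>R mat 1 + B)"
proof -
  have bl: "bounded_linear ((*v) B)" by (rule matrix_vector_mul_bounded_linear)
  let ?t = "onorm ((*v) B) + 1"
  have "x \<bullet> ((?t *\<^sub>R mat 1 + B) *v x) > 0" if "x \<noteq> 0" for x
  proof -
    have "\<bar>x \<bullet> (B *v x)\<bar> \<le> norm x * norm (B *v x)" by (rule Cauchy_Schwarz_ineq2)
    also have "\<dots> \<le> norm x * (onorm ((*v) B) * norm x)" by (intro mult_left_mono onorm bl) auto
    finally have "\<bar>x \<bullet> (B *v x)\<bar> \<le> onorm ((*v) B) * (x \<bullet> x)"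
      by (simp add: dot_square_norm power2_eq_square mult_ac)
    moreover have "x \<bullet> ((?t *\<^sub>R mat 1 + B) *v x) = onorm ((*v) B) * (x \<bullet> x) + x \<bullet> x + x \<bullet> (B *v x)"
      by (simp only: matrix_vector_mult_add_rdistrib scaleR_matrix_vector_assoc[symmetric]
          matrix_vector_mul_lid inner_add_right inner_scaleR_right) (simp add: algebra_simps)
    moreover have "x \<bullet> x > 0" using that by simp
    ultimately show ?thesis by linarith
  qed
  moreover have "transpose (?t *\<^sub>R mat 1 + B) = ?t *\<^sub>R mat 1 + B"
    by (simp only: transpose_add transpose_scalar transpose_mat assms)
  moreover have "?t > 0" using onorm_pos_le[OF bl] by linarith
  ultimately show ?thesis unfolding pos_def_def by (intro exI[of _ ?t]) auto
qed

text \<open>An infinitesimal isometry of a definite form that preserves a subspace also preserves its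
  orthogonal complement. Here column \<open>j\<close> of \<open>X\<close> is split into its part \<open>y\<close> strictly above \<open>j\<close> and
  its part \<open>z\<close> in the class of \<open>j\<close>. As \<open>L\<close> pairs \<open>y\<close> trivially both with \<open>z\<close> and, moving \<open>X\<close>
  to the other side, with the whole column, it pairs \<open>y\<close> trivially with itself.\<close>
lemma skew_block_diagonal:
  fixes L X :: "real^'v^'v"
  assumes L: "pos_def L" and comp: "\<And>i j. i \<noteq> j \<Longrightarrow> vle E i j \<or> vle E j i \<Longrightarrow> L $ i $ j = 0"
    and X: "X \<in> skew_algebra (supported_on (order_rel E)) L" and ij: "cls E i \<noteq> cls E j"
  shows "X $ i $ j = 0"
proof (cases "vle E i j")
  case True
  then have "\<not> vle E j i" using ij by (auto simp: cls_eq_iff)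
  then show ?thesis using X by (simp add: skew_algebra_def supported_on_def order_rel_def)
next
  case False
  have up: "vle E l k" if "X $ k $ l \<noteq> 0" for k l
    using X that unfolding skew_algebra_def supported_on_def order_rel_def by blast
  define x where "x = X *v axis j 1"
  have x: "x $ k = X $ k $ j" for k
    by (simp add: x_def matrix_vector_mult_basis column_def)
  define y where "y = (\<chi> k. if vle E k j then 0 else x $ k)"
  define z where "z = (\<chi> k. if vle E k j then x $ k else 0)"
  have y: "vle E j k \<and> \<not> vle E k j" if "y $ k \<noteq> 0" for k
    using that up[of k j] by (auto simp: y_def x split: if_splits)
  have z: "vle E k j" if "z $ k \<noteq> 0" for k
    using that by (auto simp: z_def split: if_splits)
  have z0: "(L *v z) $ k = 0" if "vle E j k" "\<not> vle E k j" for k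
  proof -
    have "L $ k $ l = 0 \<or> z $ l = 0" for l
      using that z[of l] comp[of k l] vle_trans[of E l j k] by (cases "k = l") auto
    then show ?thesis by (auto simp: matrix_vector_mult_def intro!: sum.neutral)
  qed
  have "y \<bullet> (L *v z) = 0"
    by (rule inner_eq_0I) (use y z0 in blast)
  moreover have "y \<bullet> (L *v x) = 0"
  proof -
    have "L ** X = - (transpose X ** L)"
      using X by (simp add: skew_algebra_def add_eq_0_iff)
    then have "L *v x = - (transpose X *v (L *v axis j 1))"
      by (simp add: x_def matrix_vector_mul_assoc)
        (simp add: matrix_vector_mult_def sum_negf vec_eq_iff)
    moreover have adj: "y \<bullet> (transpose X *v w) = (X *v y) \<bullet> w" for w
      by (metis dot_lmul_matrix inner_commute transpose_matrix_vector)
    ultimately have "y \<bullet> (L *v x) = - ((X *v y) \<bullet> (L *v axis j 1))"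
      using adj by simp
    moreover have "(X *v y) \<bullet> (L *v axis j 1) = 0"
    proof (rule inner_eq_0I)
      fix k
      show "(X *v y) $ k = 0 \<or> (L *v axis j 1) $ k = 0"
      proof (rule disjCI)
        assume "(L *v axis j 1) $ k \<noteq> 0"
        then have "L $ k $ j \<noteq> 0" by (simp add: matrix_vector_mult_basis column_def)
        then have "\<not> vle E j k \<or> k = j" using comp by blast
        then have "X $ k $ l = 0 \<or> y $ l = 0" for l
          using up[of k l] y[of l] vle_trans[of E j l k] by blast
        then show "(X *v y) $ k = 0" by (auto simp: matrix_vector_mult_def intro!: sum.neutral)
      qed
    qed
    ultimately show ?thesis by simp
  qed
  moreover have "y = x - z" by (simp add: y_def z_def vec_eq_iff)
  ultimately have "y \<bullet> (L *v y) = 0"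
    by (simp add: matrix_vector_mult_diff_distrib inner_diff_right)
  then have "y = 0" using L unfolding pos_def_def by force
  then have "y $ i = 0" by simp
  then show ?thesis using False by (simp add: y_def x)
qed


text \<open>The form \<open>L\<close> is a large multiple of the identity plus couplings between crossing classes \<open>c\<close>
  and \<open>d\<close>, the smaller of which, \<open>d\<close> say, is injected into \<open>c\<close> by a map \<open>b\<close>, with the weight
  \<open>s\<^sub>j\<close> on the pair of \<open>b j\<close> and \<open>j\<close>. By \<open>skew_block_diagonal\<close> an infinitesimal isometry \<open>X\<close> is
  block diagonal, and its blocks are skew. Compatibility with the coupling, read twice and with
  the skewness of both blocks, gives \<open>(s\<^sub>k\<^sup>2 - s\<^sub>j\<^sup>2) X\<^sub>k\<^sub>j = 0\<close> on \<open>d\<close>. As the weights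
  are positive and distinct, the block of the smaller class vanishes, and with it all entries of
  the block of \<open>c\<close> in the rows \<open>b j\<close>. Thus \<open>X\<close> lives on the set \<open>S\<close> of the
  vertices which lie in no smaller class of a crossing pair and in no image of a map \<open>b\<close>. The
  maps at a class \<open>c\<close> are chosen with a joint image as large as possible, so that
  \<open>S\<close> contains exactly \<open>excess E c\<close> of its vertices.\<close>
theorem rigid_form_exists:
  fixes E :: "'v::finite set set"
  shows "\<exists>L S. L \<in> sym_space E \<and> (\<forall>i. card (S \<inter> cls E i) = excess E (cls E i)) \<and>
     (\<forall>X. X \<in> skew_algebra (supported_on (order_rel E)) L \<longrightarrow>
       restrict_matrix (pair_set E S) X = 0 \<longrightarrow> X = 0)"
proof -
  define s where "s j = real (Suc (to_nat j))" for j :: 'v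
  have s_pos: "s j > 0" for j by (simp add: s_def)
  have s_inj: "s i = s j \<longleftrightarrow> i = j" for i j by (simp add: s_def)
  \<comment> \<open>Classes of equal size also need an orientation, as only one of the two maps may be used.\<close>
  define below :: "'v set \<Rightarrow> 'v set \<Rightarrow> bool" where
    "below d c \<longleftrightarrow> card d < card c \<or> card d = card c \<and> to_nat d < to_nat c" for d c
  have below_asym: "\<not> below c d" if "below d c" for c d
    using that by (auto simp: below_def)
  have below_total: "below c d \<or> below d c" if "c \<noteq> d" for c d
    using that unfolding below_def by (metis linorder_neqE_nat to_nat_split)
  define D where "D c = {d \<in> crossing_classes E c. below d c}" for c
  have "\<exists>b. (\<forall>d\<in>D c. inj_on b d \<and> b ` d \<subseteq> c) \<and> card (b ` \<Union>(D c)) = min (card c) (card (\<Union>(D c)))"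
    for c
  proof -
    have sub: "D c \<subseteq> range (cls E)" using crossing_classes_subset[of E c] by (auto simp: D_def)
    have "pairwise disjnt (D c)"
      unfolding pairwise_def disjnt_def
    proof (intro ballI impI)
      fix e d assume "e \<in> D c" "d \<in> D c" "e \<noteq> d"
      then show "e \<inter> d = {}" using sub by (intro classes_disjoint[of e E d]) auto
    qed
    moreover have "card d \<le> card c" if "d \<in> D c" for d
      using that by (auto simp: D_def below_def)
    ultimately show ?thesis
      unfolding card_Union_classes[OF sub] by (intro spreading_map_exists) auto
  qed
  then have "\<forall>c. \<exists>b. (\<forall>d\<in>D c. inj_on b d \<and> b ` d \<subseteq> c) \<and>
      card (b ` \<Union>(D c)) = min (card c) (card (\<Union>(D c)))" by blast
  from choice[OF this] obtain b where b: "\<And>c. (\<forall>d\<in>D c. inj_on (b c) d \<and> b c ` d \<subseteq> c) \<and>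
      card (b c ` \<Union>(D c)) = min (card c) (card (\<Union>(D c)))" by blast
  define \<beta> :: "real^'v^'v" where
    "\<beta> = (\<chi> i j. if cls E j \<in> D (cls E i) \<and> b (cls E i) j = i then s j else 0)"
  have sym_B: "transpose (\<beta> + transpose \<beta>) = \<beta> + transpose \<beta>"
    by (simp add: transpose_add add.commute)
  obtain t where t: "t > 0" "pos_def (t *\<^sub>R mat 1 + (\<beta> + transpose \<beta>))"
    using pos_def_shift[OF sym_B] by blast
  define L where "L = t *\<^sub>R mat 1 + (\<beta> + transpose \<beta>)"
  have L_pos: "pos_def L" using t(2) by (simp add: L_def)
  have L: "L $ i $ j = (if i = j then t else 0) + (\<beta> $ i $ j + \<beta> $ j $ i)" for i j
    by (simp add: L_def mat_def transpose_def)
  have D_crossing: "j \<in> crossing E i" if "cls E j \<in> D (cls E i)" for i j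
    using that by (simp add: D_def crossing_classes_iff)
  have \<beta>_crossing: "j \<in> crossing E i" if "\<beta> $ i $ j \<noteq> 0" for i j
    using that D_crossing by (auto simp: \<beta>_def split: if_splits)
  have L_crossing: "j \<in> crossing E i" if "L $ i $ j \<noteq> 0" "i \<noteq> j" for i j
  proof -
    have "\<beta> $ i $ j \<noteq> 0 \<or> \<beta> $ j $ i \<noteq> 0" using that by (auto simp: L)
    then show ?thesis using \<beta>_crossing crossing_sym by metis
  qed
  have L_comp: "L $ i $ j = 0" if "i \<noteq> j" "vle E i j \<or> vle E j i" for i j
    using L_crossing[of i j] that by (auto simp: crossing_def)
  have L_diag: "L $ i $ i = t" for i
    using \<beta>_crossing[of i i] by (auto simp: L crossing_def vle_refl)
  have L_sym_space: "L \<in> sym_space E"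
  proof -
    have "L $ i $ j = 0" if "i \<noteq> j" "{i, j} \<notin> E" for i j
      using L_crossing[of i j] that by (auto simp: crossing_def nbrs_def)
    then show ?thesis using L_pos by (auto simp: sym_space_def pos_def_def)
  qed
  have L_D: "L $ i $ j = (if b (cls E i) j = i then s j else 0)" if "cls E j \<in> D (cls E i)" for i j
  proof -
    have "cls E i \<notin> D (cls E j)" using that below_asym by (auto simp: D_def)
    moreover have "i \<noteq> j" using D_crossing[OF that] by (auto simp: crossing_def vle_refl)
    ultimately show ?thesis using that by (simp add: L \<beta>_def)
  qed
  define S where "S = {i. (\<forall>a. cls E i \<notin> D (cls E a)) \<and> i \<notin> b (cls E i) ` \<Union>(D (cls E i))}"
  have card_S: "card (S \<inter> cls E i) = excess E (cls E i)" for i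
  proof (cases "\<exists>a. cls E i \<in> D (cls E a)")
    case True
    then obtain a where a: "cls E i \<in> D (cls E a)" by blast
    have "S \<inter> cls E i = {}" using True by (auto simp: S_def in_cls_iff_eq)
    \<comment> \<open>The class at \<open>a\<close> alone has enough vertices to bring the excess down to zero.\<close>
    moreover have "card (cls E i) \<le> card (cls E a)" using a by (auto simp: D_def below_def)
    moreover have "cls E a \<in> crossing_classes E (cls E i)"
      using D_crossing[OF a] by (simp add: crossing_classes_iff crossing_sym)
    then have "cls E a \<subseteq> crossing E i" using Union_crossing_classes[of E i] by blast
    then have "card (cls E a) \<le> card (crossing E i)" by (intro card_mono) auto
    ultimately show ?thesis by (simp add: excess_cls)
  next
    case False
    have "D (cls E i) = crossing_classes E (cls E i)"
    proof (intro subset_antisym subsetI)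
      fix d assume d: "d \<in> crossing_classes E (cls E i)"
      then obtain j where j: "d = cls E j" using crossing_classes_subset by blast
      then have ji: "j \<in> crossing E i" using d by (simp add: crossing_classes_iff)
      then have "cls E j \<noteq> cls E i" by (auto simp: crossing_def cls_eq_iff)
      moreover have "\<not> below (cls E i) (cls E j)"
        using False ji by (auto simp: D_def crossing_classes_iff crossing_sym)
      ultimately show "d \<in> D (cls E i)" using below_total d j by (auto simp: D_def)
    qed (simp add: D_def)
    then have U: "\<Union>(D (cls E i)) = crossing E i" by (simp add: Union_crossing_classes)
    have "x \<in> S \<longleftrightarrow> x \<notin> b (cls E i) ` crossing E i" if "x \<in> cls E i" for x
    proof -
      have "cls E x = cls E i" using that by (simp add: in_cls_iff_eq)
      then show ?thesis using False by (simp add: S_def U)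
    qed
    then have "S \<inter> cls E i = cls E i - b (cls E i) ` crossing E i" by blast
    moreover have "b (cls E i) ` crossing E i \<subseteq> cls E i" using b[of "cls E i"] unfolding U[symmetric] by blast
    ultimately have "card (S \<inter> cls E i) = card (cls E i) - card (b (cls E i) ` crossing E i)"
      by (simp add: card_Diff_subset)
    then show ?thesis using b[of "cls E i"] by (simp add: U excess_cls)
  qed
  have "X = 0" if X: "X \<in> skew_algebra (supported_on (order_rel E)) L"
    and restr: "restrict_matrix (pair_set E S) X = 0" for X
  proof -
    have block: "X $ i $ j = 0" if "cls E i \<noteq> cls E j" for i j
      using skew_block_diagonal[OF L_pos L_comp X that] .
    have eq: "(\<Sum>k\<in>UNIV. X $ k $ i * L $ k $ j) + (\<Sum>k\<in>UNIV. L $ i $ k * X $ k $ j) = 0" for i j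
    proof -
      have "(transpose X ** L + L ** X) $ i $ j = 0" using X by (simp add: skew_algebra_def)
      then show ?thesis by (simp add: matrix_matrix_mult_def transpose_def)
    qed
    have skew: "X $ j $ i = - X $ i $ j" for i j
    proof (cases "cls E i = cls E j")
      case True
      have "X $ k $ i * L $ k $ j = (if k = j then X $ j $ i * t else 0)" for k
        using block[of k i] L_comp[of k j] True by (cases "k = j") (auto simp: cls_eq_iff L_diag)
      moreover have "L $ i $ k * X $ k $ j = (if k = i then X $ i $ j * t else 0)" for k
        using block[of k j] L_comp[of i k] vle_trans[of E i j k] True
        by (cases "k = i") (auto simp: cls_eq_iff L_diag)
      ultimately have "X $ j $ i * t + X $ i $ j * t = 0" using eq[of i j] by simp
      then have "(X $ j $ i + X $ i $ j) * t = 0" by (simp add: algebra_simps)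
      then show ?thesis using t(1) by simp
    next
      case False
      then show ?thesis using block[of i j] block[of j i] by simp
    qed
    \<comment> \<open>The entry \<open>(i, j)\<close> of \<open>X\<^sup>T L + L X = 0\<close>, where the class of \<open>j\<close> is coupled into that of
      \<open>i\<close>: in the first sum only the row \<open>b c j\<close> contributes.\<close>
    have pull: "X $ (b c j) $ i * s j + (\<Sum>k\<in>UNIV. L $ i $ k * X $ k $ j) = 0"
      if c: "c = cls E i" and j: "cls E j \<in> D c" for c i j
    proof -
      have bj: "cls E (b c j) = c" using b[of c] j c by (metis image_subset_iff in_cls_iff_eq in_cls_self)
      have "X $ k $ i * L $ k $ j = (if k = b c j then X $ (b c j) $ i * s j else 0)" for k
      proof (cases "cls E k = c")
        case True
        then show ?thesis using L_D[of j k] j by auto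
      next
        case False
        then show ?thesis using block[of k i] bj c by auto
      qed
      then show ?thesis using eq[of i j] by simp
    qed
    have pair: "X $ (b c j) $ (b c k) * s j + s k * X $ k $ j = 0"
      if "cls E k = cls E j" and j: "cls E j \<in> D c" and c: "c \<in> range (cls E)" for c j k
    proof -
      have k: "cls E k \<in> D c" using that by simp
      have inj: "inj_on (b c) (cls E j)" and sub: "b c ` cls E k \<subseteq> c" using b[of c] j k by auto
      obtain a where a: "c = cls E a" using c by blast
      have ck: "c = cls E (b c k)" using sub unfolding a by (metis image_subset_iff in_cls_iff_eq in_cls_self)
      have "L $ (b c k) $ l * X $ l $ j = (if l = k then s k * X $ k $ j else 0)" for l
      proof (cases "cls E l = cls E j")
        case True
        then have "b c l = b c k \<longleftrightarrow> l = k"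
          using inj that(1) by (auto simp: inj_on_def in_cls_iff_eq)
        then show ?thesis using L_D[of l "b c k"] True j by (simp flip: ck)
      next
        case False
        then show ?thesis using block[of l j] that(1) by auto
      qed
      then show ?thesis using pull[OF ck j] by simp
    qed
    have small0: "X $ k $ j = 0" if "cls E j \<in> D (cls E a)" for a j k
    proof (cases "cls E k = cls E j \<and> k \<noteq> j")
      case True
      let ?y = "X $ (b (cls E a) j) $ (b (cls E a) k)" and ?x = "X $ k $ j"
      have 1: "?y * s j + s k * ?x = 0" using pair[of k j "cls E a"] True that by simp
      have "- ?y * s k - s j * ?x = 0"
        using pair[of j k "cls E a"] True that
        by (simp add: skew[of "b (cls E a) j" "b (cls E a) k"] skew[of k j])
      then have 2: "?y * s k + s j * ?x = 0" by simp
      have "(s k * s k - s j * s j) * ?x = s k * (?y * s j + s k * ?x) - s j * (?y * s k + s j * ?x)"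
        by (simp add: algebra_simps)
      also have "\<dots> = 0" using 1 2 by simp
      finally have "(s k - s j) * ((s k + s j) * ?x) = 0" by (simp add: algebra_simps)
      moreover have "s k - s j \<noteq> 0" using True s_inj by auto
      moreover have "s k + s j \<noteq> 0" using s_pos[of k] s_pos[of j] by linarith
      ultimately show ?thesis by simp
    next
      case False
      then show ?thesis using block[of k j] skew[of j j] by (cases "k = j") auto
    qed
    have image0: "X $ (b (cls E i) j) $ i = 0" if "cls E j \<in> D (cls E i)" for i j
    proof -
      have "(\<Sum>k\<in>UNIV. L $ i $ k * X $ k $ j) = 0" using small0[OF that] by simp
      then show ?thesis using pull[OF refl that] s_pos[of j] by simp
    qed
    have row0: "X $ i $ j = 0" if "i \<notin> S" for i j
    proof (cases "cls E i = cls E j")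
      case True
      show ?thesis
      proof (cases "\<exists>a. cls E i \<in> D (cls E a)")
        case True
        then obtain a where "cls E j \<in> D (cls E a)" using \<open>cls E i = cls E j\<close> by auto
        then show ?thesis by (rule small0)
      next
        case False
        then obtain k d where k: "i = b (cls E i) k" "k \<in> d" "d \<in> D (cls E i)"
          using \<open>i \<notin> S\<close> by (auto simp: S_def)
        then obtain a where "d = cls E a"
          using crossing_classes_subset[of E "cls E i"] by (auto simp: D_def)
        then have "d = cls E k" using k(2) by (simp add: in_cls_iff_eq)
        then show ?thesis using image0[of k j] k True by metis
      qed
    qed (rule block)
    have "X $ i $ j = 0" for i j
    proof -
      have *: "X $ i $ j = 0" if "(i, j) \<in> pair_set E S" for i j
      proof -
        have "restrict_matrix (pair_set E S) X $ i $ j = 0" using restr by simp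
        then show ?thesis using that by (simp add: restrict_matrix_def)
      qed
      consider "cls E i \<noteq> cls E j" | "i \<notin> S" | "j \<notin> S" | "i = j" | "(i, j) \<in> pair_set E S"
        | "(j, i) \<in> pair_set E S"
        unfolding pair_set_def using linorder_neqE_nat[of "to_nat i" "to_nat j"] to_nat_split by blast
      then show ?thesis
      proof cases
        case 1 then show ?thesis by (rule block)
      next
        case 2 then show ?thesis by (rule row0)
      next
        case 3 then show ?thesis using row0[of j i] skew[of i j] by simp
      next
        case 4 then show ?thesis using skew[of i i] by simp
      next
        case 5 then show ?thesis by (rule *)
      next
        case 6 then show ?thesis using *[of j i] skew[of j i] by simp
      qed
    qed
    then show ?thesis by (simp add: vec_eq_iff)
  qed
  then show ?thesis using L_sym_space card_S by blast
qed

section \<open>The stabilizer\<close>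

lemma matrix_algebra_order: "matrix_algebra (supported_on (order_rel E))"
proof
  show "mat 1 \<in> supported_on (order_rel E)"
    by (simp add: supported_on_def order_rel_def mat_def vle_refl)
  fix X Y assume X: "X \<in> supported_on (order_rel E)" and Y: "Y \<in> supported_on (order_rel E)"
  have "X $ i $ k * Y $ k $ j = 0" if "\<not> vle E j i" for i j k
    using X Y that vle_trans[of E j k i] by (auto simp: supported_on_def order_rel_def)
  then show "X ** Y \<in> supported_on (order_rel E)"
    by (auto simp: supported_on_def order_rel_def matrix_matrix_mult_def intro!: sum.neutral)
qed (rule subspace_supported_on)

lemma G0_stabilizer_eq:
  assumes "invertible K"
  shows "G0_stabilizer E K = isom_group (supported_on (order_rel E)) K"
proof -
  interpret matrix_algebra "supported_on (order_rel E)" by (rule matrix_algebra_order)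
  have "act g K = K \<longleftrightarrow> transpose g ** K ** g = K" if g: "invertible g" for g
  proof -
    let ?h = "matrix_inv g"
    have "act g K = K \<longleftrightarrow> transpose g ** (transpose ?h ** K ** ?h) ** g = transpose g ** K ** g"
      using g by (simp add: act_def matrix_left_cancel matrix_right_cancel transpose_invertible)
    also have "transpose g ** (transpose ?h ** K ** ?h) ** g = transpose (?h ** g) ** K ** (?h ** g)"
      by (simp add: matrix_transpose_mul matrix_mul_assoc)
    finally show ?thesis using g by auto
  qed
  then show ?thesis
    using isom_group_invertible[OF assms]
    by (auto simp: G0_stabilizer_def G0_def GL_def isom_group_def supported_on_def order_rel_def)
qed

theorem proposition6p1:
  fixes E :: "'v::finite set set"
  assumes "simple_graph E"
  shows "generically E
    (\<lambda>K. has_lie_group_dim (G0_stabilizer E K) (\<Sum>c\<in>vclasses E. excess E c choose 2))"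
proof -
  let ?R = "order_rel E"
  \<comment> \<open>The same \<open>S\<close> serves for both bounds: the lower one needs only the sizes of its blocks.\<close>
  obtain L S where L: "L \<in> sym_space E" and S: "\<And>i. card (S \<inter> cls E i) = excess E (cls E i)"
    and rigid: "\<And>X. X \<in> skew_algebra (supported_on ?R) L \<Longrightarrow>
      restrict_matrix (pair_set E S) X = 0 \<Longrightarrow> X = 0"
    using rigid_form_exists by metis
  let ?Q = "pair_set E S"
  have card_Q: "card ?Q = (\<Sum>c\<in>vclasses E. excess E c choose 2)"
    unfolding card_pair_set by (intro sum.cong refl) (auto simp: vclasses_eq S)
  have Q_R: "?Q \<subseteq> ?R" by (auto simp: pair_set_def order_rel_def cls_eq_iff)
  obtain p where p: "real_polynomial_function p" "\<And>K. p K \<noteq> 0 \<longleftrightarrow> inj (gram (?Q \<union> - ?R) K)"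
    using injectivity_polynomial[OF linear_gram gram_polynomial] by metis
  have "inj (gram (?Q \<union> - ?R) L)"
  proof (rule gram_injective)
    show "transpose L = L" using L by (simp add: sym_space_def)
    fix X assume X: "transpose X ** L + L ** X = 0" "restrict_matrix (?Q \<union> - ?R) X = 0"
    have zero: "X $ i $ j = 0" if "(i, j) \<in> ?Q \<union> - ?R" for i j
    proof -
      have "restrict_matrix (?Q \<union> - ?R) X $ i $ j = 0" using X(2) by simp
      then show ?thesis using that by (simp add: restrict_matrix_def)
    qed
    show "X = 0"
    proof (rule rigid)
      show "X \<in> skew_algebra (supported_on ?R) L"
        using X(1) zero by (simp add: skew_algebra_def supported_on_def)
      show "restrict_matrix ?Q X = 0"
        using zero by (simp add: restrict_matrix_def vec_eq_iff)
    qed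
  qed
  then have "p L \<noteq> 0" by (simp add: p(2))
  moreover have "has_lie_group_dim (G0_stabilizer E K) (\<Sum>c\<in>vclasses E. excess E c choose 2)"
    if K: "K \<in> pd_cone E" "p K \<noteq> 0" for K
  proof -
    have pd: "pos_def K" and sp: "K \<in> sym_space E" using K(1) by (auto simp: pd_cone_def)
    have "dim (skew_algebra (supported_on ?R) K) \<le> card ?Q"
      using K(2) Q_R by (intro dim_skew_algebra_le) (auto simp: p(2))
    moreover have "card ?Q \<le> dim (skew_algebra (supported_on ?R) K)"
    proof (rule pair_set_le_dim[OF pd])
      show "card (S \<inter> cls E i) \<le> dim (core E K i)" for i
        using dim_core[OF sp, of i] by (simp add: S excess_cls)
    qed
    ultimately have "dim (skew_algebra (supported_on ?R) K) = (\<Sum>c\<in>vclasses E. excess E c choose 2)"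
      by (simp add: card_Q)
    then show ?thesis
      using matrix_algebra.isom_group_lie_dim[OF matrix_algebra_order[of E] pos_def_invertible[OF pd]]
      by (simp add: G0_stabilizer_eq[OF pos_def_invertible[OF pd]])
  qed
  ultimately show ?thesis unfolding generically_def using p(1) L by blast
qed

end
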